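(* Let $\lambda_0,\lambda_1,\varepsilon,\hbar\in\mathbb{R}$ and let $r\ge1$ be an integer such that $\lambda_0\varepsilon+\lambda_1r=-\hbar$ and $\lambda_0\ne0$, and let $\mathcal{E}_\hbar$ be the left $\mathcal{C}_\hbar^\infty$-module $\mathcal{S}(\mathbb{R}\times\mathbb{Z})$ with action $$(f\xi)(x,k)=\sum_{n\in\mathbb{Z}}f_n(\lambda_0x+\lambda_1k)\,\xi(x-n\varepsilon,k-nr),\qquad f=\sum_nf_n(u)W^n.$$ For $F=(F^0,F^1,\ldots,F^{r-1})\in(\mathcal{C}_\hbar^\infty)^r$ (considered as a left $\mathcal{C}_\hbar^\infty$-module) write $F^k=\sum_{n\in\mathbb{Z}}F^k_n(u)W^n$, and for an integer $k$ let $k_0\in\mathbb{Z}$ and $0\le k_1\le r-1$ be defined by $k=k_0r+k_1$. Then the map $\phi:(\mathcal{C}_\hbar^\infty)^r\to\mathcal{E}_\hbar$ defined by $$\phi(F)(x,k)=F^{k_1}_{k_0}(\lambda_0x+\lambda_1k)$$ is an isomorphism of left $\mathcal{C}_\hbar^\infty$-modules.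
   Context: For $\hbar\in\mathbb{R}$, $\mathcal{C}_\hbar^\infty$ is the vector space $\mathcal{S}(\mathbb{R}\times S^1)$ of Schwartz functions ($S^1=\mathbb{R}/\mathbb{Z}$), whose elements are written $f=\sum_{n\in\mathbb{Z}}f_n(u)W^n$ with $W=e^{2\pi it}$, $f_n\in\mathcal{S}(\mathbb{R})$, with the associative product $fg=\sum_{n}\big[\sum_{k}f_k(u)g_{n-k}(u+k\hbar)\big]W^n$. $\mathcal{S}(\mathbb{R}\times\mathbb{Z})$ is the space of Schwartz functions $\xi(x,k)$ in one real variable $x$ and one discrete variable $k$. *)

theory Defs
  imports "HOL-Analysis.Analysis" "HOL-Library.Function_Algebras"
begin

section \<open>Smooth functions\<close>

definition dir_deriv ::
    "'a::real_normed_vector \<Rightarrow> ('a \<Rightarrow> 'b::real_normed_vector) \<Rightarrow> 'a \<Rightarrow> 'b" where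
  "dir_deriv v f = (\<lambda>x. frechet_derivative f (at x) v)"

primrec Ck :: "nat \<Rightarrow> ('a::euclidean_space \<Rightarrow> 'b::real_normed_vector) \<Rightarrow> bool" where
  "Ck 0 f \<longleftrightarrow> continuous_on UNIV f"
| "Ck (Suc m) f \<longleftrightarrow> f differentiable_on UNIV \<and> (\<forall>v\<in>Basis. Ck m (dir_deriv v f))"

definition smooth :: "('a::euclidean_space \<Rightarrow> 'b::real_normed_vector) \<Rightarrow> bool" where
  "smooth f \<longleftrightarrow> (\<forall>m. Ck m f)"

section \<open>Schwartz spaces\<close>

text \<open>Functions on the cylinder (line times circle, the circle being the reals modulo the
  integers) are represented by functions of \<open>(u, t)\<close> that are 1-periodic in \<open>t\<close>.\<close>

definition schwartz_cylinder :: "(real \<times> real \<Rightarrow> complex) set" where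
  "schwartz_cylinder =
    {f. smooth f \<and> (\<forall>u t. f (u, t + 1) = f (u, t)) \<and>
        (\<forall>a b c. \<exists>B. \<forall>u t.
           \<bar>u\<bar> ^ a * norm ((dir_deriv (1, 0) ^^ b) ((dir_deriv (0, 1) ^^ c) f) (u, t)) \<le> B)}"

definition schwartz_line_int :: "(real \<times> int \<Rightarrow> complex) set" where
  "schwartz_line_int =
    {\<xi>. (\<forall>k. smooth (\<lambda>x. \<xi> (x, k))) \<and>
        (\<forall>a b c. \<exists>B. \<forall>x k.
           \<bar>x\<bar> ^ a * \<bar>of_int k\<bar> ^ c * norm ((dir_deriv 1 ^^ b) (\<lambda>y. \<xi> (y, k)) x) \<le> B)}"

section \<open>The deformed product\<close>

definition W :: "real \<Rightarrow> complex" where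
  "W t = exp (2 * of_real pi * \<i> * of_real t)"

text \<open>The coefficient \<open>f\<^sub>n(u)\<close> in the expansion of \<open>f\<close> as a sum of \<open>f\<^sub>n(u) W\<^sup>n\<close>.\<close>

definition W_coeff :: "(real \<times> real \<Rightarrow> complex) \<Rightarrow> int \<Rightarrow> real \<Rightarrow> complex" where
  "W_coeff f n u = integral {0..1} (\<lambda>t. f (u, t) * W t powi (- n))"

definition C_mult ::
    "real \<Rightarrow> (real \<times> real \<Rightarrow> complex) \<Rightarrow> (real \<times> real \<Rightarrow> complex) \<Rightarrow> real \<times> real \<Rightarrow> complex" where
  "C_mult h f g = (\<lambda>(u, t). \<Sum>\<^sub>\<infinity>n\<in>(UNIV::int set).
     (\<Sum>\<^sub>\<infinity>k\<in>(UNIV::int set). W_coeff f k u * W_coeff g (n - k) (u + of_int k * h)) * W t powi n)"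

section \<open>Algebras and left modules\<close>

text \<open>The algebras below have no unit (a nonzero constant function is not Schwartz), so the unital
  ring and module locales of the library do not apply. Carriers are complex subspaces
  of an ambient type; addition is that of the type.\<close>

locale complex_subspace = vector_space scale
  for scale :: "complex \<Rightarrow> 'a::ab_group_add \<Rightarrow> 'a" +
  fixes V :: "'a set"
  assumes subspace: "subspace V"

locale assoc_algebra = complex_subspace scale A
  for scale :: "complex \<Rightarrow> 'a::ab_group_add \<Rightarrow> 'a" and A :: "'a set" +
  fixes mult :: "'a \<Rightarrow> 'a \<Rightarrow> 'a"
  assumes mult_closed: "a \<in> A \<Longrightarrow> b \<in> A \<Longrightarrow> mult a b \<in> A"
    and mult_add_left:
      "a \<in> A \<Longrightarrow> b \<in> A \<Longrightarrow> c \<in> A \<Longrightarrow> mult (a + b) c = mult a c + mult b c"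
    and mult_add_right:
      "a \<in> A \<Longrightarrow> b \<in> A \<Longrightarrow> c \<in> A \<Longrightarrow> mult a (b + c) = mult a b + mult a c"
    and mult_scale_left: "a \<in> A \<Longrightarrow> b \<in> A \<Longrightarrow> mult (scale z a) b = scale z (mult a b)"
    and mult_scale_right: "a \<in> A \<Longrightarrow> b \<in> A \<Longrightarrow> mult a (scale z b) = scale z (mult a b)"
    and mult_assoc:
      "a \<in> A \<Longrightarrow> b \<in> A \<Longrightarrow> c \<in> A \<Longrightarrow> mult (mult a b) c = mult a (mult b c)"

locale left_module =
  alg: assoc_algebra scaleA A mult + vec: complex_subspace scaleM M
  for scaleA :: "complex \<Rightarrow> 'a::ab_group_add \<Rightarrow> 'a" and A mult
    and scaleM :: "complex \<Rightarrow> 'm::ab_group_add \<Rightarrow> 'm" and M +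
  fixes act :: "'a \<Rightarrow> 'm \<Rightarrow> 'm"
  assumes act_closed: "a \<in> A \<Longrightarrow> m \<in> M \<Longrightarrow> act a m \<in> M"
    and act_add_left: "a \<in> A \<Longrightarrow> b \<in> A \<Longrightarrow> m \<in> M \<Longrightarrow> act (a + b) m = act a m + act b m"
    and act_add_right: "a \<in> A \<Longrightarrow> m \<in> M \<Longrightarrow> n \<in> M \<Longrightarrow> act a (m + n) = act a m + act a n"
    and act_scale_left: "a \<in> A \<Longrightarrow> m \<in> M \<Longrightarrow> act (scaleA z a) m = scaleM z (act a m)"
    and act_scale_right: "a \<in> A \<Longrightarrow> m \<in> M \<Longrightarrow> act a (scaleM z m) = scaleM z (act a m)"
    and act_assoc: "a \<in> A \<Longrightarrow> b \<in> A \<Longrightarrow> m \<in> M \<Longrightarrow> act (mult a b) m = act a (act b m)"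

locale left_module_iso =
  dom: left_module scaleA A mult scaleM M actM + cod: left_module scaleA A mult scaleN N actN
  for scaleA :: "complex \<Rightarrow> 'a::ab_group_add \<Rightarrow> 'a" and A mult
    and scaleM :: "complex \<Rightarrow> 'm::ab_group_add \<Rightarrow> 'm" and M actM
    and scaleN :: "complex \<Rightarrow> 'n::ab_group_add \<Rightarrow> 'n" and N actN +
  fixes \<phi> :: "'m \<Rightarrow> 'n"
  assumes bij: "bij_betw \<phi> M N"
    and map_add: "m \<in> M \<Longrightarrow> m' \<in> M \<Longrightarrow> \<phi> (m + m') = \<phi> m + \<phi> m'"
    and map_scale: "m \<in> M \<Longrightarrow> \<phi> (scaleM z m) = scaleN z (\<phi> m)"
    and map_act: "a \<in> A \<Longrightarrow> m \<in> M \<Longrightarrow> \<phi> (actM a m) = actN a (\<phi> m)"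

definition pscale :: "complex \<Rightarrow> ('i \<Rightarrow> complex) \<Rightarrow> 'i \<Rightarrow> complex" where
  "pscale z f = (\<lambda>x. z * f x)"

text \<open>An \<open>r\<close>-tuple is a sequence indexed by the naturals that vanishes from index \<open>r\<close> on.\<close>

definition tuples :: "nat \<Rightarrow> 'a::zero set \<Rightarrow> (nat \<Rightarrow> 'a) set" where
  "tuples r A = {F. (\<forall>i<r. F i \<in> A) \<and> (\<forall>i\<ge>r. F i = 0)}"

definition tuple_scale ::
    "(complex \<Rightarrow> 'a \<Rightarrow> 'a) \<Rightarrow> complex \<Rightarrow> (nat \<Rightarrow> 'a) \<Rightarrow> nat \<Rightarrow> 'a" where
  "tuple_scale sc z F = (\<lambda>i. sc z (F i))"

definition tuple_act :: "nat \<Rightarrow> ('a \<Rightarrow> 'a \<Rightarrow> 'a) \<Rightarrow> 'a \<Rightarrow> (nat \<Rightarrow> 'a::zero) \<Rightarrow> nat \<Rightarrow> 'a" where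
  "tuple_act r m a F = (\<lambda>i. if i < r then m a (F i) else 0)"

definition E_act ::
    "real \<Rightarrow> real \<Rightarrow> real \<Rightarrow> nat \<Rightarrow>
     (real \<times> real \<Rightarrow> complex) \<Rightarrow> (real \<times> int \<Rightarrow> complex) \<Rightarrow> real \<times> int \<Rightarrow> complex" where
  "E_act l0 l1 \<epsilon> r f \<xi> = (\<lambda>(x, k). \<Sum>\<^sub>\<infinity>n\<in>(UNIV::int set).
     W_coeff f n (l0 * x + l1 * of_int k) * \<xi> (x - of_int n * \<epsilon>, k - n * int r))"

definition phi ::
    "real \<Rightarrow> real \<Rightarrow> nat \<Rightarrow> (nat \<Rightarrow> real \<times> real \<Rightarrow> complex) \<Rightarrow> real \<times> int \<Rightarrow> complex" where
  "phi l0 l1 r F = (\<lambda>(x, k).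
     W_coeff (F (nat (k mod int r))) (k div int r) (l0 * x + l1 * of_int k))"

end

theory Submission
  imports Defs
begin

text \<open>Taking Fourier coefficients in the circle variable identifies the algebra with the rapidly
  decreasing families \<open>c\<^sub>n(u)\<close>, with the twisted convolution as product. Injectivity comes from
  Chernoff's proof of Fourier uniqueness, surjectivity from termwise differentiation of the series.
  On coefficients, \<open>phi\<close> only interleaves \<open>r\<close> families and changes the position by an affine map,
  so it is bijective, and \<open>\<lambda>\<^sub>0\<epsilon> + \<lambda>\<^sub>1r = -h\<close> turns the action into the convolution. The module axioms
  of the target are then transported along \<open>phi\<close>.\<close>

section \<open>Series and smooth functions\<close>

text \<open>A Schwartz space prescribes bounds for derivatives of every order, while convolutions
  and Fourier series offer a convenient formula only for the first derivative. This is why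
  \<open>rapid\<close> is coinductive: a family carries its own decay bounds and a derivative of the
  same kind, so each closure property reduces to undifferentiated bounds and one differentiation.
  The single weight 1 + |x| + |k| treats decay in position and in index together, and decay survives
  a change of variables as soon as the old weight is at most a constant times the new one. Here
  \<open>l0 \<noteq> 0\<close> and \<open>r \<ge> 1\<close> enter: x and k are controlled by l0 x +
  l1 k and k div r. Since the algebra has no unit, compatibility of \<open>phi\<close> with the
  action cannot be tested on unit vectors; it is verified coefficient by coefficient on every
  tuple.\<close>

lemma summable_on_comparison_norm:
  fixes a :: "'i \<Rightarrow> 'b::banach"
  assumes "\<And>n. norm (a n) \<le> M n" and "M summable_on A"
  shows "a summable_on A"
  using assms by (meson Infinite_Sum.abs_summable_on_comparison_test' abs_summable_summable)

lemma int_decode_sums_infsum: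
  fixes a :: "int \<Rightarrow> 'b::banach"
  assumes "a summable_on UNIV"
  shows "(\<lambda>i. a (int_decode i)) sums (\<Sum>\<^sub>\<infinity>n. a n)"
proof -
  have "(a has_sum (\<Sum>\<^sub>\<infinity>n. a n)) UNIV"
    using assms by simp
  then have "((\<lambda>i. a (int_decode i)) has_sum (\<Sum>\<^sub>\<infinity>n. a n)) UNIV"
    using has_sum_reindex_bij_betw[OF bij_int_decode, of a] by simp
  then show ?thesis
    by (rule has_sum_imp_sums)
qed

text \<open>Weierstrass test for derivatives: \<open>M\<close> majorizes the terms and the operator
  norms of their derivatives, so the tails of the derivative series are at most a tail of
  \<open>M\<close> times |v|, uniformly in x. The integers are enumerated by
  \<open>int_decode\<close> to reach the theorem on sequences.\<close>

lemma has_derivative_infsum_int: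
  fixes f :: "int \<Rightarrow> 'a::real_normed_vector \<Rightarrow> 'b::banach"
  assumes der: "\<And>n x. (f n has_derivative f' n x) (at x)"
    and f_le: "\<And>n x. norm (f n x) \<le> M n"
    and f'_le: "\<And>n x v. norm (f' n x v) \<le> M n * norm v"
    and M: "M summable_on UNIV"
  shows "((\<lambda>x. \<Sum>\<^sub>\<infinity>n. f n x) has_derivative (\<lambda>v. \<Sum>\<^sub>\<infinity>n. f' n x v)) (at x)"
proof -
  have f_sums: "(\<lambda>i. f (int_decode i) x) sums (\<Sum>\<^sub>\<infinity>n. f n x)" for x
    by (rule int_decode_sums_infsum, rule summable_on_comparison_norm[OF f_le M])
  have f'_sums: "(\<lambda>i. f' (int_decode i) x v) sums (\<Sum>\<^sub>\<infinity>n. f' n x v)" for x v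
    by (rule int_decode_sums_infsum, rule summable_on_comparison_norm[OF f'_le])
      (use M summable_on_cmult_left in blast)
  define m where "m = (\<lambda>i. M (int_decode i))"
  have m: "summable m"
    using int_decode_sums_infsum[OF M] by (auto simp: m_def sums_iff)
  have tail: "norm ((\<Sum>i<n. f' (int_decode i) x v) - (\<Sum>\<^sub>\<infinity>n. f' n x v)) \<le> (\<Sum>i. m (i + n)) * norm v"
    for n :: nat and x v
  proof -
    have "(\<lambda>i. f' (int_decode (i + n)) x v) sums ((\<Sum>\<^sub>\<infinity>n. f' n x v) - (\<Sum>i<n. f' (int_decode i) x v))"
      using sums_split_initial_segment[OF f'_sums] .
    then have "norm ((\<Sum>\<^sub>\<infinity>n. f' n x v) - (\<Sum>i<n. f' (int_decode i) x v)) 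
        = norm (\<Sum>i. f' (int_decode (i + n)) x v)"
      by (simp add: sums_iff)
    also have "\<dots> \<le> (\<Sum>i. m (i + n) * norm v)"
    proof (rule norm_suminf_le)
      show "norm (f' (int_decode (i + n)) x v) \<le> m (i + n) * norm v" for i
        using f'_le by (simp add: m_def)
      show "summable (\<lambda>i. m (i + n) * norm v)"
        using m by (intro summable_mult2) (simp add: summable_iff_shift)
    qed
    also have "\<dots> = (\<Sum>i. m (i + n)) * norm v"
      using m by (intro suminf_mult2[symmetric]) (simp add: summable_iff_shift)
    finally show ?thesis
      by (simp add: norm_minus_commute)
  qed
  have "\<exists>g. \<forall>x\<in>UNIV. (\<lambda>i. f (int_decode i) x) sums g x \<and>
      (g has_derivative (\<lambda>v. \<Sum>\<^sub>\<infinity>n. f' n x v)) (at x within UNIV)"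
  proof (rule has_derivative_series[where x = x])
    show "(f (int_decode n) has_derivative f' (int_decode n) x) (at x)" for n x
      by (rule der)
    show "(\<lambda>n. f (int_decode n) x) sums (\<Sum>\<^sub>\<infinity>n. f n x)"
      by (rule f_sums)
    fix e :: real assume "e > 0"
    then obtain N where N: "\<And>n. n \<ge> N \<Longrightarrow> norm (\<Sum>i. m (i + n)) < e"
      using suminf_exist_split[OF _ m] by blast
    have "norm ((\<Sum>i<n. f' (int_decode i) x v) - (\<Sum>\<^sub>\<infinity>n. f' n x v)) \<le> e * norm v" if "n \<ge> N" for n :: nat and x v
      using N[OF that] tail[where n = n and x = x and v = v] mult_right_mono[of "\<Sum>i. m (i + n)" e "norm v"] by force
    then show "\<forall>\<^sub>F n in sequentially. \<forall>x\<in>UNIV. \<forall>v.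
        norm ((\<Sum>i<n. f' (int_decode i) x v) - (\<Sum>\<^sub>\<infinity>n. f' n x v)) \<le> e * norm v"
      unfolding eventually_sequentially by blast
  qed auto
  then obtain g where g: "\<And>x. (\<lambda>i. f (int_decode i) x) sums g x"
      "\<And>x. (g has_derivative (\<lambda>v. \<Sum>\<^sub>\<infinity>n. f' n x v)) (at x)"
    by auto
  \<comment> \<open>The series theorem yields only some limit function; uniqueness of limits
    identifies it.\<close>
  have "g = (\<lambda>x. \<Sum>\<^sub>\<infinity>n. f n x)"
    using sums_unique2[OF g(1) f_sums] by (auto simp: fun_eq_iff)
  with g(2) show ?thesis
    by simp
qed

text \<open>One fixed summable majorant: constant multiples of it dominate every series over the
  integers that is summed or differentiated below.\<close>

definition int_decay :: "int \<Rightarrow> real" where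
  "int_decay n = 1 / (1 + \<bar>of_int n\<bar>)\<^sup>2"

lemma summable_int_decay: "int_decay summable_on UNIV"
proof -
  have "summable (\<lambda>n. 1 / real (Suc n) ^ 2)"
    using inverse_power_summable[of 2, where 'a = real]
    by (subst summable_Suc_iff[of "\<lambda>n. 1 / real n ^ 2"]) (simp add: inverse_eq_divide)
  then have nat: "(\<lambda>n. 1 / (1 + real n)\<^sup>2) summable_on UNIV"
    by (subst summable_on_UNIV_nonneg_real_iff) (auto simp: add.commute)
  have "int_decay summable_on (range int)"
    using nat by (subst summable_on_reindex) (auto simp: int_decay_def o_def)
  moreover have "int_decay summable_on (range (\<lambda>n. - int n))"
    using nat by (subst summable_on_reindex) (auto simp: int_decay_def o_def inj_on_def)
  moreover have "(UNIV :: int set) = range int \<union> range (\<lambda>n. - int n)"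
    by (auto intro: int_cases2)
  ultimately show ?thesis
    by (metis summable_on_union)
qed

section \<open>Smoothness through closure under partial derivatives\<close>

lemma dir_deriv_eq:
  assumes "(f has_derivative f') (at x)"
  shows "dir_deriv v f x = f' v"
  using frechet_derivative_at[OF assms] by (simp add: dir_deriv_def)

text \<open>Induction on the order with the function arbitrary. The class \<open>X\<close> is chosen
  later as a set of functions of one shape, such as all \<open>synth c\<close> with \<open>c\<close>
  rapid.\<close>

lemma smooth_coinduct:
  assumes "X f"
    and "\<And>f. X f \<Longrightarrow> f differentiable_on UNIV \<and> (\<forall>v\<in>Basis. X (dir_deriv v f))"
  shows "smooth f"
proof -
  have "Ck m f" if "X f" for m f
    using that assms(2)
    by (induction m arbitrary: f) (auto intro: differentiable_imp_continuous_on)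
  with assms(1) show ?thesis
    by (simp add: smooth_def)
qed

lemma smooth_differentiable: "smooth f \<Longrightarrow> f differentiable (at x)"
  unfolding smooth_def
  by (metis Ck.simps(2) differentiable_on_eq_differentiable_at iso_tuple_UNIV_I open_UNIV)

lemma smooth_continuous: "smooth f \<Longrightarrow> continuous_on UNIV f"
  unfolding smooth_def by (metis Ck.simps(1))

lemma smooth_dir_deriv: "smooth f \<Longrightarrow> v \<in> Basis \<Longrightarrow> smooth (dir_deriv v f)"
  unfolding smooth_def by (metis Ck.simps(2))

section \<open>Rapidly decreasing families\<close>

text \<open>The summand 1 keeps the weight at least 1, which makes it submultiplicative when an
  index n is split as k + (n - k); this is what convolution needs.\<close>

definition weight :: "real \<Rightarrow> int \<Rightarrow> real" where
  "weight x k = 1 + \<bar>x\<bar> + \<bar>of_int k\<bar>"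

lemma weight_ge_1: "1 \<le> weight x k"
  by (simp add: weight_def)

lemma weight_pos: "0 < weight x k"
  using weight_ge_1[of x k] by linarith

text \<open>The weight is at most three times the largest of 1, |x| and |k|, and the N-th power of
  the largest is one of the three powers on the right.\<close>

lemma weight_power_le:
  "weight x k ^ N \<le> 3 ^ N * (1 + \<bar>x\<bar> ^ N + \<bar>of_int k\<bar> ^ N)"
proof -
  define y where "y = max 1 (max \<bar>x\<bar> \<bar>of_int k\<bar>)"
  have "weight x k ^ N \<le> (3 * y) ^ N"
    by (rule power_mono) (auto simp: weight_def y_def)
  also have "\<dots> = 3 ^ N * y ^ N"
    by (rule power_mult_distrib)
  also have "y ^ N \<le> 1 + \<bar>x\<bar> ^ N + \<bar>of_int k\<bar> ^ N"
    by (simp add: y_def max_def)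
  finally show ?thesis
    by simp
qed

lemma monomial_le_weight:
  "\<bar>x\<bar> ^ a * \<bar>of_int k\<bar> ^ c \<le> weight x k ^ (a + c)"
  unfolding power_add
  by (intro mult_mono power_mono) (auto simp: weight_def)

text \<open>Coinduction replaces the quantification over the order of the derivative.\<close>

coinductive rapid :: "(int \<Rightarrow> real \<Rightarrow> complex) \<Rightarrow> bool" where
  rapidI: "rapid c" if "\<And>k x. (c k has_vector_derivative c' k x) (at x)"
    and "\<And>N. \<exists>B. \<forall>k x. weight x k ^ N * norm (c k x) \<le> B" and "rapid c'"

lemma rapid_deriv:
  assumes "rapid c"
  shows "\<exists>c'. (\<forall>k x. (c k has_vector_derivative c' k x) (at x)) \<and> rapid c'"
  using assms by cases blast

lemma rapid_bound:
  assumes "rapid c"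
  shows "\<exists>B\<ge>0. \<forall>k x. weight x k ^ N * norm (c k x) \<le> B"
proof -
  from assms obtain B where "\<And>k x. weight x k ^ N * norm (c k x) \<le> B"
    by cases blast
  then show ?thesis
    by (intro exI[of _ "\<bar>B\<bar>"]) (auto intro: order_trans[OF _ abs_ge_self])
qed

text \<open>Growth of order m in the index costs m further powers of the weight. The case of
  interest is the factor 2 pi i n produced by a derivative along the circle.\<close>

lemma rapid_multiplier:
  assumes "rapid c" and q: "\<And>k. norm (q k) \<le> C * (1 + \<bar>of_int k\<bar>) ^ m"
  shows "rapid (\<lambda>k x. q k * c k x)"
proof -
  define X where "X e \<longleftrightarrow> (\<exists>c. rapid c \<and> e = (\<lambda>k x. q k * c k x))" for e
  \<comment> \<open>At k = 0 the polynomial factor is 1, which yields the sign of \<open>C\<close>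
    required for the monotonicity steps.\<close>
  have "0 \<le> norm (q 0)"
    by simp
  also have "norm (q 0) \<le> C"
    using q[of 0] by simp
  finally have "0 \<le> C" .
  have "X (\<lambda>k x. q k * c k x)"
    using assms(1) X_def by blast
  then show ?thesis
  proof (coinduct rule: rapid.coinduct)
    case (rapid e)
    then obtain c where c: "rapid c" and e: "e = (\<lambda>k x. q k * c k x)"
      by (auto simp: X_def)
    obtain c' where c': "\<And>k x. (c k has_vector_derivative c' k x) (at x)" "rapid c'"
      using rapid_deriv[OF c] by blast
    have "\<exists>B. \<forall>k x. weight x k ^ N * norm (e k x) \<le> B" for N
    proof -
      obtain B where B: "\<And>k x. weight x k ^ (m + N) * norm (c k x) \<le> B"
        using rapid_bound[OF c] by blast
      have "weight x k ^ N * norm (e k x) \<le> C * B" for k x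
      proof -
        have "weight x k ^ N * norm (e k x)
            \<le> weight x k ^ N * ((C * (1 + \<bar>of_int k\<bar>) ^ m) * norm (c k x))"
          unfolding e norm_mult using weight_pos[of x k]
          by (intro mult_left_mono mult_right_mono q) auto
        also have "\<dots> \<le> weight x k ^ N * ((C * weight x k ^ m) * norm (c k x))"
          using weight_pos[of x k] \<open>0 \<le> C\<close>
          by (intro mult_left_mono mult_right_mono power_mono) (auto simp: weight_def)
        also have "\<dots> = C * (weight x k ^ (m + N) * norm (c k x))"
          by (simp add: power_add)
        also have "\<dots> \<le> C * B"
          using B \<open>0 \<le> C\<close> by (intro mult_left_mono)
        finally show ?thesis .
      qed
      then show ?thesis
        by blast
    qed
    moreover have "(e k has_vector_derivative q k * c' k x) (at x)" for k x
      unfolding e by (intro has_vector_derivative_mult_right c')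
    ultimately show ?case
      using c'(2) by (intro exI[of _ e] exI[of _ "\<lambda>k x. q k * c' k x"]) (auto simp: X_def)
  qed
qed

lemma rapid_scale: "rapid c \<Longrightarrow> rapid (\<lambda>k x. z * c k x)"
  by (rule rapid_multiplier[where m = 0 and C = "norm z"]) auto

lemma bounded_add:
  fixes f g :: "'i \<Rightarrow> 'j \<Rightarrow> 'b::real_normed_vector"
  assumes "\<exists>B. \<forall>k x. w k x * norm (f k x) \<le> B" "\<exists>B. \<forall>k x. w k x * norm (g k x) \<le> B"
    and w: "\<And>k x. w k x \<ge> 0"
  shows "\<exists>B. \<forall>k x. w k x * norm (f k x + g k x) \<le> (B :: real)"
proof -
  obtain B1 B2 where B: "\<And>k x. w k x * norm (f k x) \<le> B1" "\<And>k x. w k x * norm (g k x) \<le> B2"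
    using assms by blast
  have "w k x * norm (f k x + g k x) \<le> B1 + B2" for k x
  proof -
    have "w k x * norm (f k x + g k x) \<le> w k x * norm (f k x) + w k x * norm (g k x)"
      using mult_left_mono[OF norm_triangle_ineq w] by (simp add: distrib_left)
    with B show ?thesis
      by (smt (verit, best))
  qed
  then show ?thesis
    by blast
qed

lemma rapid_add:
  assumes "rapid c" "rapid d"
  shows "rapid (\<lambda>k x. c k x + d k x)"
proof -
  define X where "X e \<longleftrightarrow> (\<exists>c d. rapid c \<and> rapid d \<and> e = (\<lambda>k x. c k x + d k x))" for e
  have "X (\<lambda>k x. c k x + d k x)"
    using assms X_def by blast
  then show ?thesis
  proof (coinduct rule: rapid.coinduct)
    case (rapid e)
    then obtain c d where cd: "rapid c" "rapid d" and e: "e = (\<lambda>k x. c k x + d k x)"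
      by (auto simp: X_def)
    obtain c' where c': "\<And>k x. (c k has_vector_derivative c' k x) (at x)" "rapid c'"
      using rapid_deriv[OF cd(1)] by blast
    obtain d' where d': "\<And>k x. (d k has_vector_derivative d' k x) (at x)" "rapid d'"
      using rapid_deriv[OF cd(2)] by blast
    have "\<exists>B. \<forall>k x. weight x k ^ N * norm (e k x) \<le> B" for N
      unfolding e using weight_pos
      by (intro bounded_add) (use cd rapid_bound in blast, use cd rapid_bound in blast, auto intro: less_imp_le)
    moreover have "(e k has_vector_derivative c' k x + d' k x) (at x)" for k x
      unfolding e by (intro has_vector_derivative_add c' d')
    ultimately show ?case
      using c'(2) d'(2) by (intro exI[of _ e] exI[of _ "\<lambda>k x. c' k x + d' k x"]) (auto simp: X_def)
  qed
qed

lemma rapid_zero: "rapid (\<lambda>k x. 0)"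
proof -
  define X :: "(int \<Rightarrow> real \<Rightarrow> complex) \<Rightarrow> bool" where "X e \<longleftrightarrow> e = (\<lambda>k x. 0)" for e
  have "X (\<lambda>k x. 0)"
    by (simp add: X_def)
  then show ?thesis
    by (coinduct rule: rapid.coinduct) (force simp: X_def)
qed

text \<open>Serves both directions of the isomorphism: \<open>phi\<close> interleaves r families
  with slope l0, its inverse reads off one family with slope 1 / l0. The hypothesis on weights is
  all that remains to be checked in each case.\<close>

lemma rapid_reparam:
  fixes c :: "nat \<Rightarrow> int \<Rightarrow> real \<Rightarrow> complex"
  assumes c: "\<And>i. i < r \<Longrightarrow> rapid (c i)" and \<iota>: "\<And>k. \<iota> k < r"
    and w: "\<And>x k. weight x k \<le> C * weight (\<alpha> * x + s k) (\<sigma> k)"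
  shows "rapid (\<lambda>k x. c (\<iota> k) (\<sigma> k) (\<alpha> * x + s k))"
proof -
  \<comment> \<open>The scalar z belongs to the invariant because the chain rule brings out a factor
    \<alpha> at every derivative.\<close>
  define X where "X e \<longleftrightarrow> (\<exists>z c. (\<forall>i<r. rapid (c i)) \<and>
      e = (\<lambda>k x. z * c (\<iota> k) (\<sigma> k) (\<alpha> * x + s k)))" for e
  have "X (\<lambda>k x. c (\<iota> k) (\<sigma> k) (\<alpha> * x + s k))"
    unfolding X_def using c by (intro exI[of _ 1] exI[of _ c]) auto
  then show ?thesis
  proof (coinduct rule: rapid.coinduct)
    case (rapid e)
    then obtain z c where c: "\<And>i. i < r \<Longrightarrow> rapid (c i)"
      and e: "e = (\<lambda>k x. z * c (\<iota> k) (\<sigma> k) (\<alpha> * x + s k))"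
      by (auto simp: X_def)
    have "\<forall>i\<in>{..<r}. \<exists>c'. (\<forall>k x. (c i k has_vector_derivative c' k x) (at x)) \<and> rapid c'"
      using rapid_deriv[OF c] by blast
    from bchoice[OF this] obtain c' where c': "\<And>i k x. i < r \<Longrightarrow> (c i k has_vector_derivative c' i k x) (at x)"
        "\<And>i. i < r \<Longrightarrow> rapid (c' i)"
      by (metis lessThan_iff)
    have "\<exists>B. \<forall>k x. weight x k ^ N * norm (e k x) \<le> B" for N
    proof -
      have "\<forall>i\<in>{..<r}. \<exists>B. B \<ge> 0 \<and> (\<forall>k x. weight x k ^ N * norm (c i k x) \<le> B)"
        using rapid_bound[OF c] by blast
      from bchoice[OF this] obtain B where B: "\<And>i. i < r \<Longrightarrow> B i \<ge> 0"
          "\<And>i k x. i < r \<Longrightarrow> weight x k ^ N * norm (c i k x) \<le> B i"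
        by (metis lessThan_iff)
      have "weight x k ^ N * norm (e k x) \<le> C ^ N * norm z * (\<Sum>i<r. B i)" for k x
      proof -
        define y where "y = \<alpha> * x + s k"
        have "0 < C * weight y (\<sigma> k)"
          using w[of x k] weight_pos[of x k] by (auto simp: y_def)
        then have "0 \<le> C"
          using weight_pos[of y "\<sigma> k"] by (simp add: zero_less_mult_iff)
        have "weight x k ^ N * norm (e k x) \<le> (C * weight y (\<sigma> k)) ^ N * norm (e k x)"
          using w weight_pos[of x k] unfolding y_def
          by (intro mult_right_mono power_mono) (auto intro: less_imp_le)
        also have "\<dots> = C ^ N * norm z * (weight y (\<sigma> k) ^ N * norm (c (\<iota> k) (\<sigma> k) y))"
          by (simp add: e y_def norm_mult power_mult_distrib)
        also have "\<dots> \<le> C ^ N * norm z * (\<Sum>i<r. B i)"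
        proof (intro mult_left_mono)
          \<comment> \<open>The selected family varies with k; the sum of the finitely many
            nonnegative bounds covers every choice.\<close>
          show "weight y (\<sigma> k) ^ N * norm (c (\<iota> k) (\<sigma> k) y) \<le> (\<Sum>i<r. B i)"
            using B(2)[OF \<iota>, of y "\<sigma> k" k] member_le_sum[of "\<iota> k" "{..<r}" B] B(1) \<iota>[of k]
            by fastforce
        qed (use \<open>0 \<le> C\<close> in auto)
        finally show ?thesis .
      qed
      then show ?thesis
        by blast
    qed
    moreover have "(e k has_vector_derivative z * \<alpha> * c' (\<iota> k) (\<sigma> k) (\<alpha> * x + s k)) (at x)" for k x
    proof -
      have "((\<lambda>x. \<alpha> * x + s k) has_vector_derivative \<alpha>) (at x)"
        by (auto intro!: derivative_eq_intros)
      from vector_diff_chain_at[OF this c'(1)[OF \<iota>]]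
      have "((\<lambda>x. c (\<iota> k) (\<sigma> k) (\<alpha> * x + s k)) has_vector_derivative
          \<alpha> *\<^sub>R c' (\<iota> k) (\<sigma> k) (\<alpha> * x + s k)) (at x)"
        by (simp add: o_def)
      then have "((\<lambda>x. z * c (\<iota> k) (\<sigma> k) (\<alpha> * x + s k)) has_vector_derivative
          z * (\<alpha> *\<^sub>R c' (\<iota> k) (\<sigma> k) (\<alpha> * x + s k))) (at x)"
        by (rule has_vector_derivative_mult_right)
      then show ?thesis
        by (simp add: e scaleR_conv_of_real mult.assoc)
    qed
    ultimately show ?case
      using c'(2) unfolding X_def
      by (intro exI[of _ e] exI[of _ "\<lambda>k x. z * \<alpha> * c' (\<iota> k) (\<sigma> k) (\<alpha> * x + s k)"]) blast
  qed
qed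

section \<open>Schwartz functions on the line times the integers as rapid families\<close>

lemma dir_deriv_1_eq:
  assumes "\<And>x. (f has_vector_derivative f' x) (at x)"
  shows "dir_deriv 1 f = f'"
  using dir_deriv_eq[OF assms[unfolded has_vector_derivative_def]] by (simp add: fun_eq_iff)

lemma smooth_vector_derivative:
  assumes "smooth (f :: real \<Rightarrow> 'b::real_normed_vector)"
  shows "(f has_vector_derivative dir_deriv 1 f x) (at x)"
proof -
  have der: "(f has_derivative frechet_derivative f (at x)) (at x)"
    using smooth_differentiable[OF assms] by (simp add: frechet_derivative_works)
  have "frechet_derivative f (at x) t = t *\<^sub>R frechet_derivative f (at x) 1" for t
    using linear_simps(5)[OF has_derivative_bounded_linear[OF der], of t 1]
    unfolding real_scaleR_def mult_1_right .
  then have "frechet_derivative f (at x) = (\<lambda>t. t *\<^sub>R frechet_derivative f (at x) 1)"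
    by (rule ext)
  then show ?thesis
    unfolding has_vector_derivative_def dir_deriv_def by (rule has_derivative_eq_rhs[OF der])
qed

text \<open>From left to right the Schwartz conditions are themselves the coinductive invariant,
  since they pass to the derivative. From right to left the bound follows by induction on the order
  of the derivative with the family arbitrary.\<close>

lemma schwartz_line_int_iff_rapid:
  "\<xi> \<in> schwartz_line_int \<longleftrightarrow> rapid (\<lambda>k x. \<xi> (x, k))"
proof
  define X :: "(int \<Rightarrow> real \<Rightarrow> complex) \<Rightarrow> bool" where
    "X c \<longleftrightarrow> (\<forall>k. smooth (c k)) \<and> (\<forall>a b m. \<exists>B. \<forall>x k.
           \<bar>x\<bar> ^ a * \<bar>of_int k\<bar> ^ m * norm ((dir_deriv 1 ^^ b) (c k) x) \<le> B)" for c
  assume "\<xi> \<in> schwartz_line_int"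
  then have "X (\<lambda>k x. \<xi> (x, k))"
    by (auto simp: schwartz_line_int_def X_def)
  then show "rapid (\<lambda>k x. \<xi> (x, k))"
  proof (coinduct rule: rapid.coinduct)
    case (rapid c)
    have "(c k has_vector_derivative dir_deriv 1 (c k) x) (at x)" for k x
      using rapid by (intro smooth_vector_derivative) (auto simp: X_def)
    moreover have "\<exists>B. \<forall>k x. weight x k ^ N * norm (c k x) \<le> B" for N
    proof -
      have bd: "\<exists>B. \<forall>x k. \<bar>x\<bar> ^ a * \<bar>of_int k\<bar> ^ m * norm (c k x) \<le> B" for a m
        using conjunct2[OF rapid[unfolded X_def], rule_format, of a m 0] by simp
      obtain B0 where B0: "\<And>x k. norm (c k x) \<le> B0"
        using bd[of 0 0] by auto
      obtain B1 where B1: "\<And>x k. \<bar>x\<bar> ^ N * norm (c k x) \<le> B1"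
        using bd[of N 0] by auto
      obtain B2 where B2: "\<And>x k. \<bar>of_int k\<bar> ^ N * norm (c k x) \<le> B2"
        using bd[of 0 N] by auto
      have "weight x k ^ N * norm (c k x) \<le> 3 ^ N * (B0 + B1 + B2)" for x k
      proof -
        have "weight x k ^ N * norm (c k x) \<le> 3 ^ N * (1 + \<bar>x\<bar> ^ N + \<bar>of_int k\<bar> ^ N) * norm (c k x)"
          by (intro mult_right_mono weight_power_le) auto
        also have "\<dots> = 3 ^ N * (norm (c k x) + \<bar>x\<bar> ^ N * norm (c k x) + \<bar>of_int k\<bar> ^ N * norm (c k x))"
          by (simp add: algebra_simps)
        also have "\<dots> \<le> 3 ^ N * (B0 + B1 + B2)"
          by (intro mult_left_mono add_mono B0 B1 B2) auto
        finally show ?thesis .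
      qed
      then show ?thesis
        by blast
    qed
    moreover have "X (\<lambda>k. dir_deriv 1 (c k))"
    proof -
      have "\<exists>B. \<forall>x k. \<bar>x\<bar> ^ a * \<bar>of_int k\<bar> ^ m * norm ((dir_deriv 1 ^^ b) (dir_deriv 1 (c k)) x) \<le> B"
        for a b m
        \<comment> \<open>The bound of order b + 1, with the iterate unfolded from the right so that
          the innermost derivative becomes the new family.\<close>
        using conjunct2[OF rapid[unfolded X_def], rule_format, of a m "Suc b"]
        by (simp add: funpow_Suc_right del: funpow.simps)
      then show ?thesis
        using rapid by (auto simp: X_def smooth_dir_deriv)
    qed
    ultimately show ?case
      by (intro exI[of _ c] exI[of _ "\<lambda>k. dir_deriv 1 (c k)"]) simp
  qed
next
  assume \<xi>: "rapid (\<lambda>k x. \<xi> (x, k))"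
  have "smooth (c k)" if "rapid c" for c k
  proof -
    define X where "X f \<longleftrightarrow> (\<exists>c. rapid c \<and> f = c k)" for f
    have "X (c k)"
      using that X_def by blast
    then show ?thesis
    proof (rule smooth_coinduct)
      fix f assume "X f"
      then obtain c c' where "f = c k" "rapid c'" and c': "\<And>k x. (c k has_vector_derivative c' k x) (at x)"
        unfolding X_def using rapid_deriv by blast
      then show "f differentiable_on UNIV \<and> (\<forall>v\<in>Basis. X (dir_deriv v f))"
        using dir_deriv_1_eq[of "c k" "c' k", OF c'] unfolding X_def
        by (auto intro!: differentiableI_vector simp: differentiable_on_eq_differentiable_at)
    qed
  qed
  moreover have "\<exists>B. \<forall>x k. \<bar>x\<bar> ^ a * \<bar>of_int k\<bar> ^ m * norm ((dir_deriv 1 ^^ b) (c k) x) \<le> B"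
    if "rapid c" for a b m c
    using that
  proof (induction b arbitrary: c)
    case 0
    then obtain B where B: "\<And>k x. weight x k ^ (a + m) * norm (c k x) \<le> B"
      using rapid_bound by blast
    have "\<bar>x\<bar> ^ a * \<bar>of_int k\<bar> ^ m * norm (c k x) \<le> B" for x k
      using mult_right_mono[OF monomial_le_weight norm_ge_zero] B order_trans by blast
    then show ?case
      by auto
  next
    case (Suc b)
    then obtain c' where c': "rapid c'" "\<And>k x. (c k has_vector_derivative c' k x) (at x)"
      using rapid_deriv by blast
    have "dir_deriv 1 (c k) = c' k" for k
      using c'(2) by (rule dir_deriv_1_eq)
    then show ?case
      using Suc.IH[OF c'(1)] by (simp add: funpow_Suc_right del: funpow.simps)
  qed
  ultimately have "smooth (\<lambda>x. \<xi> (x, k))"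
      "\<exists>B. \<forall>x k. \<bar>x\<bar> ^ a * \<bar>of_int k\<bar> ^ m * norm ((dir_deriv 1 ^^ b) (\<lambda>y. \<xi> (y, k)) x) \<le> B" for k a m b
    using \<xi> by blast+
  then show "\<xi> \<in> schwartz_line_int"
    by (simp add: schwartz_line_int_def)
qed

section \<open>Summable majorants for rapid families\<close>

lemma int_decay_pos: "0 < int_decay n"
  by (auto simp: int_decay_def)

lemma has_vector_derivative_infsum_int:
  fixes f :: "int \<Rightarrow> real \<Rightarrow> 'b::banach"
  assumes "\<And>n x. (f n has_vector_derivative f' n x) (at x)"
    and "\<And>n x. norm (f n x) \<le> M n" and "\<And>n x. norm (f' n x) \<le> M n"
    and "M summable_on UNIV"
  shows "((\<lambda>x. \<Sum>\<^sub>\<infinity>n. f n x) has_vector_derivative (\<Sum>\<^sub>\<infinity>n. f' n x)) (at x)"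
proof -
  have "((\<lambda>x. \<Sum>\<^sub>\<infinity>n. f n x) has_derivative (\<lambda>t. \<Sum>\<^sub>\<infinity>n. t *\<^sub>R f' n x)) (at x)"
  proof (rule has_derivative_infsum_int[OF _ _ _ assms(4)])
    show "norm (t *\<^sub>R f' n x) \<le> M n * norm t" for n x t
      using mult_right_mono[OF assms(3) abs_ge_zero, of n x t] by (simp add: mult.commute)
  qed (use assms in \<open>auto simp: has_vector_derivative_def\<close>)
  then show ?thesis
    by (simp add: has_vector_derivative_def infsum_scaleR_right)
qed

lemma norm_infsum_le_infsum:
  fixes f :: "'i \<Rightarrow> 'b::banach"
  assumes "\<And>n. norm (f n) \<le> M n" "M summable_on A"
  shows "norm (\<Sum>\<^sub>\<infinity>n\<in>A. f n) \<le> (\<Sum>\<^sub>\<infinity>n\<in>A. M n)"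
  by (rule norm_infsum_le[OF has_sum_infsum has_sum_infsum])
    (use assms summable_on_comparison_norm in blast)+

text \<open>Two of the N + 2 available powers of the weight are at least (1 + |k|) squared and pay
  for \<open>int_decay\<close>.\<close>

lemma rapid_decay:
  assumes "rapid c"
  shows "\<exists>B\<ge>0. \<forall>k x. weight x k ^ N * norm (c k x) \<le> B * int_decay k"
proof -
  obtain B where B: "B \<ge> 0" "\<And>k x. weight x k ^ (2 + N) * norm (c k x) \<le> B"
    using rapid_bound[OF assms] by blast
  have "weight x k ^ N * norm (c k x) \<le> B * int_decay k" for k x
  proof -
    have "(1 + \<bar>of_int k\<bar>)\<^sup>2 * (weight x k ^ N * norm (c k x))
        \<le> weight x k ^ 2 * (weight x k ^ N * norm (c k x))"
      using weight_pos[of x k]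
      by (intro mult_right_mono power_mono) (auto simp: weight_def)
    also have "\<dots> \<le> B"
      using B(2)[of x k] by (simp add: power_add power2_eq_square mult.assoc)
    finally show ?thesis
      by (simp add: int_decay_def field_simps)
  qed
  with B(1) show ?thesis
    by blast
qed

lemma rapid_norm_le_decay:
  assumes "rapid c"
  shows "\<exists>B\<ge>0. \<forall>k x. norm (c k x) \<le> B * int_decay k"
  using rapid_decay[OF assms, of 0] by simp

lemma summable_int_decay_scaled: "(\<lambda>n. B * int_decay n) summable_on UNIV"
  by (intro summable_on_cmult_right summable_int_decay)

section \<open>The twisted convolution\<close>

text \<open>The product of the crossed product of functions on the line by the integers acting
  through translation by h, separated from the circle variable so that the algebra laws become
  statements about double series.\<close>

definition conv :: "real \<Rightarrow> (int \<Rightarrow> real \<Rightarrow> complex) \<Rightarrow> (int \<Rightarrow> real \<Rightarrow> complex) \<Rightarrow> int \<Rightarrow> real \<Rightarrow> complex" where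
  "conv h c d n u = (\<Sum>\<^sub>\<infinity>k\<in>UNIV. c k u * d (n - k) (u + of_int k * h))"

text \<open>From \<open>weight u n \<le> weight u k * weight v (n - k)\<close> the N-th power splits
  between the two factors. The translated position v does no harm, because |u| is already absorbed
  by the weight of \<open>c\<close>. The bound is uniform in n and u and summable in k.\<close>

lemma conv_term_bound:
  assumes "rapid c" "rapid d"
  shows "\<exists>B\<ge>0. \<forall>n k u. weight u n ^ N * norm (c k u * d (n - k) (u + of_int k * h)) \<le> B * int_decay k"
proof -
  obtain B1 where B1: "B1 \<ge> 0" "\<And>k x. weight x k ^ N * norm (c k x) \<le> B1 * int_decay k"
    using rapid_decay[OF assms(1)] by blast
  obtain B2 where B2: "B2 \<ge> 0" "\<And>k x. weight x k ^ N * norm (d k x) \<le> B2"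
    using rapid_bound[OF assms(2)] by blast
  have "weight u n ^ N * norm (c k u * d (n - k) (u + of_int k * h)) \<le> (B1 * B2) * int_decay k" for n k u
  proof -
    define v where "v = u + of_int k * h"
    have "weight u n \<le> weight u k + \<bar>of_int (n - k)\<bar>"
      by (simp add: weight_def)
    also have "\<dots> \<le> weight u k + weight u k * \<bar>of_int (n - k)\<bar>"
      using mult_right_mono[OF weight_ge_1[of u k], of "\<bar>of_int (n - k)\<bar>"] by simp
    also have "\<dots> = weight u k * (1 + \<bar>of_int (n - k)\<bar>)"
      by (simp add: distrib_left)
    also have "\<dots> \<le> weight u k * weight v (n - k)"
      using weight_pos[of u k] by (intro mult_left_mono) (auto simp: weight_def)
    finally have le: "weight u n \<le> weight u k * weight v (n - k)" .
    have "weight u n ^ N * norm (c k u * d (n - k) v)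
        \<le> (weight u k * weight v (n - k)) ^ N * norm (c k u * d (n - k) v)"
      using weight_pos[of u n] by (intro mult_right_mono power_mono le) auto
    also have "\<dots> = (weight u k ^ N * norm (c k u)) * (weight v (n - k) ^ N * norm (d (n - k) v))"
      by (simp add: norm_mult power_mult_distrib)
    also have "\<dots> \<le> (B1 * int_decay k) * B2"
      using B1 B2 int_decay_pos[of k] weight_pos[of v "n - k"] by (intro mult_mono[OF B1(2) B2(2)]) auto
    finally show ?thesis
      by (simp add: v_def mult_ac)
  qed
  then show ?thesis
    using B1(1) B2(1) by (intro exI[of _ "B1 * B2"]) auto
qed

lemma conv_summable:
  assumes "rapid c" "rapid d"
  shows "(\<lambda>k. c k u * d (n - k) (u + of_int k * h)) summable_on UNIV"
proof -
  obtain B where "\<And>n k u. norm (c k u * d (n - k) (u + of_int k * h)) \<le> B * int_decay k"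
    using conv_term_bound[OF assms, of 0 h] by auto
  then show ?thesis
    by (rule summable_on_comparison_norm[OF _ summable_int_decay_scaled])
qed

lemma conv_bound:
  assumes "rapid c" "rapid d"
  shows "\<exists>B. \<forall>n u. weight u n ^ N * norm (conv h c d n u) \<le> B"
proof -
  obtain B where B: "\<And>n k u. weight u n ^ N * norm (c k u * d (n - k) (u + of_int k * h)) \<le> B * int_decay k"
    using conv_term_bound[OF assms, of N] by blast
  have "weight u n ^ N * norm (conv h c d n u) \<le> (\<Sum>\<^sub>\<infinity>k. B * int_decay k)" for n u
  proof -
    have "weight u n ^ N * norm (conv h c d n u)
        = norm (\<Sum>\<^sub>\<infinity>k\<in>UNIV. of_real (weight u n ^ N) * (c k u * d (n - k) (u + of_int k * h)))"
      using weight_pos[of u n]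
      by (simp add: conv_def infsum_cmult_right' norm_mult norm_power del: of_real_power)
    also have "\<dots> \<le> (\<Sum>\<^sub>\<infinity>k. B * int_decay k)"
      using B[of u n] weight_pos[of u n]
      by (intro norm_infsum_le_infsum summable_int_decay_scaled)
        (simp add: norm_mult[of "of_real _"] del: of_real_power)
    finally show ?thesis .
  qed
  then show ?thesis
    by blast
qed

lemma conv_has_vector_derivative:
  assumes c: "rapid c" "\<And>k x. (c k has_vector_derivative c' k x) (at x)" "rapid c'"
    and d: "rapid d" "\<And>k x. (d k has_vector_derivative d' k x) (at x)" "rapid d'"
  shows "(conv h c d n has_vector_derivative conv h c' d n u + conv h c d' n u) (at u)"
proof -
  let ?t = "\<lambda>c d k u. c k u * d (n - k) (u + of_int k * h) :: complex"
  obtain B0 where B0: "B0 \<ge> 0" "\<And>k u. norm (?t c d k u) \<le> B0 * int_decay k"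
    using conv_term_bound[OF c(1) d(1), of 0 h] by auto
  obtain B1 where B1: "B1 \<ge> 0" "\<And>k u. norm (?t c' d k u) \<le> B1 * int_decay k"
    using conv_term_bound[OF c(3) d(1), of 0 h] by auto
  obtain B2 where B2: "B2 \<ge> 0" "\<And>k u. norm (?t c d' k u) \<le> B2 * int_decay k"
    using conv_term_bound[OF c(1) d(3), of 0 h] by auto
  have "((\<lambda>u. \<Sum>\<^sub>\<infinity>k. ?t c d k u) has_vector_derivative (\<Sum>\<^sub>\<infinity>k. ?t c' d k u + ?t c d' k u)) (at u)"
  \<comment> \<open>One majorant has to serve the terms and their derivatives: \<open>B0\<close>
    bounds the product, \<open>B1\<close> and \<open>B2\<close> the two summands of the product
    rule.\<close>
  proof (rule has_vector_derivative_infsum_int[where M = "\<lambda>k. (B0 + B1 + B2) * int_decay k"])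
    fix k u
    have shift: "((\<lambda>u. u + of_int k * h) has_vector_derivative 1) (at u)"
      by (auto intro!: derivative_eq_intros)
    have "((\<lambda>u. d (n - k) (u + of_int k * h)) has_vector_derivative d' (n - k) (u + of_int k * h)) (at u)"
      using vector_diff_chain_at[OF shift d(2)] by (simp add: o_def)
    from has_vector_derivative_mult[OF c(2) this]
    show "(?t c d k has_vector_derivative ?t c' d k u + ?t c d' k u) (at u)"
      by (simp add: add.commute)
    have pos: "0 \<le> B0 * int_decay k" "0 \<le> B1 * int_decay k" "0 \<le> B2 * int_decay k"
      using B0(1) B1(1) B2(1) int_decay_pos[of k] by auto
    then show "norm (?t c d k u) \<le> (B0 + B1 + B2) * int_decay k"
      using B0(2)[of k u] by (simp add: distrib_right)
    show "norm (?t c' d k u + ?t c d' k u) \<le> (B0 + B1 + B2) * int_decay k"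
      using norm_triangle_ineq[of "?t c' d k u" "?t c d' k u"] B1(2)[of k u] B2(2)[of k u] pos
      unfolding distrib_right by linarith
  qed (rule summable_int_decay_scaled)
  also have "(\<Sum>\<^sub>\<infinity>k. ?t c' d k u + ?t c d' k u) = conv h c' d n u + conv h c d' n u"
    using c d by (simp add: conv_def infsum_add conv_summable)
  finally show ?thesis
    by (simp add: conv_def[abs_def])
qed

inductive conv_sum :: "real \<Rightarrow> (int \<Rightarrow> real \<Rightarrow> complex) \<Rightarrow> bool" for h where
  conv: "rapid c \<Longrightarrow> rapid d \<Longrightarrow> conv_sum h (conv h c d)"
| add: "conv_sum h a \<Longrightarrow> conv_sum h b \<Longrightarrow> conv_sum h (\<lambda>n u. a n u + b n u)"

text \<open>By the product rule the derivative of a convolution is a sum of two convolutions, so the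
  coinduction has to run over finite sums.\<close>

lemma rapid_conv:
  assumes "rapid c" "rapid d"
  shows "rapid (conv h c d)"
proof -
  have "conv_sum h (conv h c d)"
    using assms by (rule conv_sum.conv)
  then show ?thesis
  proof (coinduct rule: rapid.coinduct)
    case (rapid e)
    \<comment> \<open>The two coinduction requirements are proved together, by induction on how the
      sum of convolutions was formed.\<close>
    have "(\<forall>N. \<exists>B. \<forall>k x. weight x k ^ N * norm (e k x) \<le> B) \<and>
        (\<exists>e'. conv_sum h e' \<and> (\<forall>k x. (e k has_vector_derivative e' k x) (at x)))"
      using rapid
    proof induction
      case (conv c d)
      obtain c' where c': "\<And>k x. (c k has_vector_derivative c' k x) (at x)" "rapid c'"
        using rapid_deriv[OF conv(1)] by blast
      obtain d' where d': "\<And>k x. (d k has_vector_derivative d' k x) (at x)" "rapid d'"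
        using rapid_deriv[OF conv(2)] by blast
      have "conv_sum h (\<lambda>n u. conv h c' d n u + conv h c d' n u)"
        using conv c' d' by (intro conv_sum.intros)
      then show ?case
        using conv_bound[OF conv] conv_has_vector_derivative[OF conv(1) c' conv(2) d'] by blast
    next
      case (add a b)
      then obtain a' b' where "conv_sum h a'" "\<And>k x. (a k has_vector_derivative a' k x) (at x)"
          and "conv_sum h b'" "\<And>k x. (b k has_vector_derivative b' k x) (at x)"
        by blast
      then have "\<exists>e'. conv_sum h e' \<and> (\<forall>k x. ((\<lambda>u. a k u + b k u) has_vector_derivative e' k x) (at x))"
        by (intro exI[of _ "\<lambda>k x. a' k x + b' k x"])
          (auto intro: conv_sum.add has_vector_derivative_add)
      moreover have "\<exists>B. \<forall>k x. weight x k ^ N * norm (a k x + b k x) \<le> B" for N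
        using add.IH weight_pos by (intro bounded_add) (auto intro: less_imp_le)
      ultimately show ?case
        by blast
    qed
    then show ?case
      by blast
  qed
qed

lemma conv_add_left:
  assumes "rapid a" "rapid b" "rapid c"
  shows "conv h (\<lambda>k x. a k x + b k x) c = (\<lambda>n u. conv h a c n u + conv h b c n u)"
  using assms by (simp add: conv_def fun_eq_iff distrib_right infsum_add conv_summable)

lemma conv_add_right:
  assumes "rapid a" "rapid b" "rapid c"
  shows "conv h a (\<lambda>k x. b k x + c k x) = (\<lambda>n u. conv h a b n u + conv h a c n u)"
  using assms by (simp add: conv_def fun_eq_iff distrib_left infsum_add conv_summable)

lemma conv_scale_left: "conv h (\<lambda>k x. z * a k x) b = (\<lambda>n u. z * conv h a b n u)"
  by (simp add: conv_def fun_eq_iff mult.assoc infsum_cmult_right')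

lemma conv_scale_right: "conv h a (\<lambda>k x. z * b k x) = (\<lambda>n u. z * conv h a b n u)"
  by (simp add: conv_def fun_eq_iff mult.left_commute[of _ z] infsum_cmult_right')

lemma bij_int_diff: "bij (\<lambda>k::int. k - j)"
  by (rule bij_betw_byWitness[where f' = "\<lambda>k. k + j"]) auto

text \<open>Both sides sum \<open>F j k\<close> over all pairs, in opposite orders. On the right the
  inner index is shifted by j, and the translations agree because j h + (k - j) h = k h.\<close>

lemma conv_assoc:
  assumes "rapid a" "rapid b" "rapid c"
  shows "conv h (conv h a b) c = conv h a (conv h b c)"
proof (intro ext)
  fix n u
  define F where "F j k = a j u * b (k - j) (u + of_int j * h) * c (n - k) (u + of_int k * h)" for j k
  obtain A where A: "A \<ge> 0" "\<And>k x. norm (a k x) \<le> A * int_decay k"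
    using rapid_norm_le_decay[OF assms(1)] by blast
  obtain B where B: "B \<ge> 0" "\<And>k x. norm (b k x) \<le> B * int_decay k"
    using rapid_norm_le_decay[OF assms(2)] by blast
  obtain C where C: "C \<ge> 0" "\<And>k x. norm (c k x) \<le> C"
    using rapid_bound[OF assms(3), of 0] by auto
  \<comment> \<open>Decay of \<open>a\<close> controls j and decay of \<open>b\<close> controls k -
    j, while \<open>c\<close> enters through its uniform bound. By translation invariance each row
    sums to a fixed multiple of \<open>int_decay j\<close>.\<close>
  define G where "G = (\<lambda>(j, k). C * (A * int_decay j * (B * int_decay (k - j))))"
  have G: "G summable_on (UNIV \<times> UNIV)"
  proof (rule summable_on_SigmaI)
    fix j
    have "((\<lambda>k. int_decay (k - j)) has_sum (\<Sum>\<^sub>\<infinity>k. int_decay k)) UNIV"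
      using summable_int_decay has_sum_reindex_bij_betw[OF bij_int_diff, of int_decay j] by simp
    then show "((\<lambda>k. G (j, k)) has_sum C * (A * int_decay j * (B * (\<Sum>\<^sub>\<infinity>k. int_decay k)))) UNIV"
      unfolding G_def prod.case by (intro has_sum_cmult_right)
    show "0 \<le> G (j, k)" for k
      using A(1) B(1) C(1) int_decay_pos[of j] int_decay_pos[of "k - j"] by (simp add: G_def)
  next
    show "(\<lambda>j. C * (A * int_decay j * (B * (\<Sum>\<^sub>\<infinity>k. int_decay k)))) summable_on UNIV"
      by (intro summable_on_cmult_right summable_on_cmult_left summable_int_decay)
  qed
  have F: "norm (case p of (j, k) \<Rightarrow> F j k) \<le> G p" for p
  proof (cases p)
    case (Pair j k)
    have "norm (F j k) = norm (c (n - k) (u + of_int k * h)) *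
        (norm (a j u) * norm (b (k - j) (u + of_int j * h)))"
      by (simp add: F_def norm_mult)
    also have "\<dots> \<le> C * (A * int_decay j * (B * int_decay (k - j)))"
      using A B C int_decay_pos[of j] by (intro mult_mono) auto
    finally show ?thesis
      by (simp add: Pair G_def)
  qed
  have summable: "(\<lambda>(j, k). F j k) summable_on (UNIV \<times> UNIV)"
    by (rule summable_on_comparison_norm[OF F G])
  have "conv h (conv h a b) c n u = (\<Sum>\<^sub>\<infinity>k. \<Sum>\<^sub>\<infinity>j. F j k)"
    by (simp add: conv_def F_def infsum_cmult_left')
  also have "\<dots> = (\<Sum>\<^sub>\<infinity>j. \<Sum>\<^sub>\<infinity>k. F j k)"
    using summable by (rule infsum_swap_banach[symmetric])
  also have "\<dots> = conv h a (conv h b c) n u"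
  proof -
    have "(\<Sum>\<^sub>\<infinity>k. F j k) = a j u * conv h b c (n - j) (u + of_int j * h)" for j
    proof -
      have "conv h b c (n - j) (u + of_int j * h)
          = (\<Sum>\<^sub>\<infinity>k. b (k - j) (u + of_int j * h) * c (n - j - (k - j)) (u + of_int j * h + of_int (k - j) * h))"
        unfolding conv_def by (rule infsum_reindex_bij_betw[OF bij_int_diff, symmetric])
      also have "\<dots> = (\<Sum>\<^sub>\<infinity>k. b (k - j) (u + of_int j * h) * c (n - k) (u + of_int k * h))"
        by (simp add: algebra_simps)
      finally show ?thesis
        by (simp add: F_def mult.assoc infsum_cmult_right')
    qed
    then show ?thesis
      by (simp add: conv_def[of h a])
  qed
  finally show "conv h (conv h a b) c n u = conv h a (conv h b c) n u" .
qed

section \<open>Synthesis\<close>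

definition synth :: "(int \<Rightarrow> real \<Rightarrow> complex) \<Rightarrow> real \<times> real \<Rightarrow> complex" where
  "synth c = (\<lambda>(u, t). \<Sum>\<^sub>\<infinity>n\<in>UNIV. c n u * W t powi n)"

lemma C_mult_eq_synth: "C_mult h f g = synth (conv h (W_coeff f) (W_coeff g))"
  by (simp add: C_mult_def synth_def conv_def)

lemma W_powi: "W t powi n = cis (2 * pi * of_int n * t)"
proof -
  have "W t = cis (2 * pi * t)"
    by (simp add: W_def cis_conv_exp mult_ac)
  then show ?thesis
    by (simp add: cis_power_int mult_ac)
qed

lemma W_periodic: "W (t + 1) = W t"
  using W_powi[of "t + 1" 1] W_powi[of t 1] by (simp add: distrib_left cis_mult[symmetric])

lemma norm_W_powi: "norm (W t powi n) = 1"
  by (simp add: W_powi)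

lemma W_powi_vector_derivative:
  "((\<lambda>t. W t powi n) has_vector_derivative 2 * pi * \<i> * of_int n * W t powi n) (at t)"
proof -
  have "((\<lambda>z. exp (2 * pi * \<i> * of_int n * z)) has_field_derivative
      2 * pi * \<i> * of_int n * exp (2 * pi * \<i> * of_int n * of_real t)) (at (of_real t))"
    by (auto intro!: derivative_eq_intros)
  from has_vector_derivative_real_field[OF this] show ?thesis
    by (simp add: W_powi cis_conv_exp mult_ac)
qed

lemma continuous_on_W_powi [continuous_intros]: "continuous_on S (\<lambda>t. W t powi n)"
  unfolding W_powi by (intro continuous_intros)

lemma synth_summable:
  assumes "rapid c"
  shows "(\<lambda>n. c n u * W t powi n) summable_on UNIV"
proof -
  obtain B where "\<And>k x. norm (c k x) \<le> B * int_decay k"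
    using rapid_norm_le_decay[OF assms] by blast
  then have "norm (c n u * W t powi n) \<le> B * int_decay n" for n
    by (simp add: norm_mult norm_W_powi)
  then show ?thesis
    by (rule summable_on_comparison_norm[OF _ summable_int_decay_scaled])
qed

lemma rapid_times_index: "rapid c \<Longrightarrow> rapid (\<lambda>n x. 2 * pi * \<i> * of_int n * c n x)"
  by (rule rapid_multiplier[where C = "2 * pi" and m = 1]) (auto simp: norm_mult)

text \<open>Each partial derivative of a series is again a series of a rapid family: along the line
  the coefficients are differentiated, along the circle they are multiplied by 2 pi i n.\<close>

lemma synth_has_derivative:
  assumes c: "rapid c" "\<And>k x. (c k has_vector_derivative c' k x) (at x)" "rapid c'"
  shows "(synth c has_derivative
      (\<lambda>v. fst v *\<^sub>R synth c' p + snd v *\<^sub>R synth (\<lambda>n x. 2 * pi * \<i> * of_int n * c n x) p)) (at p)"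
proof -
  let ?d = "\<lambda>n x. 2 * pi * \<i> * of_int n * c n x"
  have d: "rapid ?d"
    using c(1) by (rule rapid_times_index)
  let ?t = "\<lambda>c n p. c n (fst p) * W (snd p) powi n :: complex"
  obtain B0 where B0: "B0 \<ge> 0" "\<And>k x. norm (c k x) \<le> B0 * int_decay k"
    using rapid_norm_le_decay[OF c(1)] by blast
  obtain B1 where B1: "B1 \<ge> 0" "\<And>k x. norm (c' k x) \<le> B1 * int_decay k"
    using rapid_norm_le_decay[OF c(3)] by blast
  obtain B2 where B2: "B2 \<ge> 0" "\<And>k x. norm (?d k x) \<le> B2 * int_decay k"
    using rapid_norm_le_decay[OF d] by blast
  have "((\<lambda>p. \<Sum>\<^sub>\<infinity>n. ?t c n p) has_derivative
      (\<lambda>v. \<Sum>\<^sub>\<infinity>n. fst v *\<^sub>R ?t c' n p + snd v *\<^sub>R ?t ?d n p)) (at p)"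
  proof (rule has_derivative_infsum_int[where M = "\<lambda>n. (B0 + B1 + B2) * int_decay n"])
    fix n and p :: "real \<times> real"
    have "((\<lambda>p. c n (fst p)) has_derivative (\<lambda>v. fst v *\<^sub>R c' n (fst p))) (at p)"
      by (rule has_derivative_compose[OF has_derivative_fst[OF has_derivative_ident]
            c(2)[unfolded has_vector_derivative_def]])
    moreover have "((\<lambda>p. W (snd p) powi n) has_derivative
        (\<lambda>v. snd v *\<^sub>R (2 * pi * \<i> * of_int n * W (snd p) powi n))) (at p)"
      by (rule has_derivative_compose[OF has_derivative_snd[OF has_derivative_ident]
            W_powi_vector_derivative[unfolded has_vector_derivative_def]])
    ultimately have "((\<lambda>p. ?t c n p) has_derivative (\<lambda>v. c n (fst p) *
          (snd v *\<^sub>R (2 * pi * \<i> * of_int n * W (snd p) powi n)) +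
        (fst v *\<^sub>R c' n (fst p)) * W (snd p) powi n)) (at p)"
      by (rule has_derivative_mult)
    then show "((\<lambda>p. ?t c n p) has_derivative (\<lambda>v. fst v *\<^sub>R ?t c' n p + snd v *\<^sub>R ?t ?d n p)) (at p)"
      by (rule has_derivative_eq_rhs) (auto simp: fun_eq_iff scaleR_conv_of_real algebra_simps)
    have pos: "0 \<le> B0 * int_decay n" "0 \<le> B1 * int_decay n" "0 \<le> B2 * int_decay n"
      using B0(1) B1(1) B2(1) int_decay_pos[of n] by auto
    then show "norm (?t c n p) \<le> (B0 + B1 + B2) * int_decay n"
      using B0(2)[of n "fst p"] by (simp add: distrib_right norm_mult norm_W_powi)
    fix v :: "real \<times> real"
    have "norm (fst v *\<^sub>R ?t c' n p + snd v *\<^sub>R ?t ?d n p)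
        \<le> \<bar>fst v\<bar> * norm (?t c' n p) + \<bar>snd v\<bar> * norm (?t ?d n p)"
      using norm_triangle_ineq[of "fst v *\<^sub>R ?t c' n p" "snd v *\<^sub>R ?t ?d n p"] by simp
    also have "\<dots> = \<bar>fst v\<bar> * norm (c' n (fst p)) + \<bar>snd v\<bar> * norm (?d n (fst p))"
      by (simp only: norm_mult norm_W_powi mult_1_right)
    also have "\<dots> \<le> norm v * (B1 * int_decay n) + norm v * (B2 * int_decay n)"
      using norm_fst_le[of "fst v" "snd v"] norm_snd_le[of "snd v" "fst v"]
      by (intro add_mono mult_mono B1(2) B2(2)) auto
    also have "\<dots> \<le> (B0 + B1 + B2) * int_decay n * norm v"
      using mult_left_mono[OF pos(1) norm_ge_zero[of v]] by (simp add: algebra_simps)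
    finally show "norm (fst v *\<^sub>R ?t c' n p + snd v *\<^sub>R ?t ?d n p) \<le> (B0 + B1 + B2) * int_decay n * norm v" .
  qed (rule summable_int_decay_scaled)
  moreover have "(\<Sum>\<^sub>\<infinity>n. fst v *\<^sub>R ?t c' n p + snd v *\<^sub>R ?t ?d n p)
      = fst v *\<^sub>R synth c' p + snd v *\<^sub>R synth ?d p" for v
    using synth_summable[OF c(3)] synth_summable[OF d]
    by (simp add: infsum_add infsum_scaleR_right summable_on_scaleR_right synth_def case_prod_beta)
  ultimately show ?thesis
    by (simp add: synth_def case_prod_unfold)
qed

lemma dir_deriv_synth:
  assumes c: "rapid c" "\<And>k x. (c k has_vector_derivative c' k x) (at x)" "rapid c'"
  shows "dir_deriv (1, 0) (synth c) = synth c'"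
    and "dir_deriv (0, 1) (synth c) = synth (\<lambda>n x. 2 * pi * \<i> * of_int n * c n x)"
  using dir_deriv_eq[OF synth_has_derivative[OF c]] by (auto simp: fun_eq_iff)

text \<open>All mixed derivatives of \<open>synth c\<close> are again of the form
  \<open>synth c'\<close> with \<open>c'\<close> rapid, so the Schwartz bounds reduce to the
  undifferentiated one, \<open>bd\<close>.\<close>

lemma synth_in_cylinder:
  assumes "rapid c"
  shows "synth c \<in> schwartz_cylinder"
proof -
  have du: "\<exists>c'. rapid c' \<and> (dir_deriv (1, 0) ^^ b) (synth c) = synth c'" if "rapid c" for b c
    using that
  proof (induction b)
    case (Suc b)
    then obtain c' where c': "rapid c'" "(dir_deriv (1, 0) ^^ b) (synth c) = synth c'"
      by blast
    obtain c'' where "\<And>k x. (c' k has_vector_derivative c'' k x) (at x)" "rapid c''"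
      using rapid_deriv[OF c'(1)] by blast
    with c' dir_deriv_synth(1)[OF c'(1)] show ?case
      by auto
  qed auto
  have dt: "\<exists>c'. rapid c' \<and> (dir_deriv (0, 1) ^^ b) (synth c) = synth c'" if "rapid c" for b c
    using that
  proof (induction b)
    case (Suc b)
    then obtain c' where c': "rapid c'" "(dir_deriv (0, 1) ^^ b) (synth c) = synth c'"
      by blast
    obtain c'' where "\<And>k x. (c' k has_vector_derivative c'' k x) (at x)" "rapid c''"
      using rapid_deriv[OF c'(1)] by blast
    with c' dir_deriv_synth(2)[OF c'(1)] rapid_times_index[OF c'(1)] show ?case
      by auto
  qed auto
  have bd: "\<exists>B. \<forall>u t. \<bar>u\<bar> ^ a * norm (synth c (u, t)) \<le> B" if c: "rapid c" for a c
  proof -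
    obtain B where B: "\<And>k x. weight x k ^ a * norm (c k x) \<le> B * int_decay k"
      using rapid_decay[OF c] by blast
    have "\<bar>u\<bar> ^ a * norm (synth c (u, t)) \<le> (\<Sum>\<^sub>\<infinity>n. B * int_decay n)" for u t
    proof -
      have "\<bar>u\<bar> ^ a * norm (synth c (u, t)) = norm (\<Sum>\<^sub>\<infinity>n\<in>UNIV. of_real (\<bar>u\<bar> ^ a) * (c n u * W t powi n))"
        by (simp add: synth_def infsum_cmult_right' norm_mult norm_power del: of_real_power)
      also have "\<dots> \<le> (\<Sum>\<^sub>\<infinity>n. B * int_decay n)"
      proof (intro norm_infsum_le_infsum summable_int_decay_scaled)
        fix n
        have "norm (of_real (\<bar>u\<bar> ^ a) * (c n u * W t powi n)) = \<bar>u\<bar> ^ a * norm (c n u)"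
          by (simp add: norm_mult norm_W_powi norm_power)
        also have "\<dots> \<le> weight u n ^ a * norm (c n u)"
          by (intro mult_right_mono power_mono) (auto simp: weight_def)
        finally show "norm (of_real (\<bar>u\<bar> ^ a) * (c n u * W t powi n)) \<le> B * int_decay n"
          using B[of u n] by linarith
      qed
      finally show ?thesis .
    qed
    then show ?thesis
      by blast
  qed
  define X where "X f \<longleftrightarrow> (\<exists>c. rapid c \<and> f = synth c)" for f
  have "X (synth c)"
    using assms X_def by blast
  then have "smooth (synth c)"
  proof (rule smooth_coinduct)
    fix f assume "X f"
    then obtain c c' where c: "f = synth c" "rapid c" "rapid c'" "\<And>k x. (c k has_vector_derivative c' k x) (at x)"
      unfolding X_def using rapid_deriv by blast
    have "f differentiable_on UNIV"
      unfolding c(1) differentiable_on_def differentiable_def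
      using synth_has_derivative[OF c(2,4,3)] by auto
    moreover have "X (dir_deriv v f)" if "v \<in> Basis" for v
      using that dir_deriv_synth[OF c(2,4,3)] c rapid_times_index[OF c(2)]
      by (auto simp: Basis_prod_def X_def)
    ultimately show "f differentiable_on UNIV \<and> (\<forall>v\<in>Basis. X (dir_deriv v f))"
      by blast
  qed
  moreover have "synth c (u, t + 1) = synth c (u, t)" for u t
    by (simp add: synth_def W_periodic)
  moreover have "\<exists>B. \<forall>u t. \<bar>u\<bar> ^ a * norm ((dir_deriv (1, 0) ^^ b) ((dir_deriv (0, 1) ^^ m) (synth c)) (u, t)) \<le> B" for a b m
  proof -
    obtain c' where c': "rapid c'" "(dir_deriv (0, 1) ^^ m) (synth c) = synth c'"
      using dt[OF assms] by blast
    obtain c'' where "rapid c''" "(dir_deriv (1, 0) ^^ b) (synth c') = synth c''"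
      using du[OF c'(1)] by blast
    with c' bd show ?thesis
      by simp
  qed
  ultimately show ?thesis
    by (simp add: schwartz_cylinder_def)
qed

section \<open>Orthogonality of the powers of \<open>W\<close> and the coefficients of a
  series\<close>

lemma integral_W_powi: "((\<lambda>t. W t powi n) has_integral (if n = 0 then 1 else 0)) {0..1}"
proof (cases "n = 0")
  case True
  then show ?thesis
    using has_integral_const_real[of "1 :: complex" 0 1] by simp
next
  case False
  have W01: "W 1 = W 0"
    using W_periodic[of 0] by simp
  have "((\<lambda>t. W t powi n) has_integral
      (W 1 powi n / (2 * pi * \<i> * of_int n) - W 0 powi n / (2 * pi * \<i> * of_int n))) {0..1}"
  proof (rule fundamental_theorem_of_calculus)
    fix t :: real
    have "((\<lambda>t. W t powi n / (2 * pi * \<i> * of_int n)) has_vector_derivative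
        2 * pi * \<i> * of_int n * W t powi n / (2 * pi * \<i> * of_int n)) (at t)"
      by (intro has_vector_derivative_divide W_powi_vector_derivative)
    then show "((\<lambda>t. W t powi n / (2 * pi * \<i> * of_int n)) has_vector_derivative W t powi n) (at t within {0..1})"
      using False by (simp add: has_vector_derivative_at_within)
  qed simp
  with False W01 show ?thesis
    by simp
qed

lemma W_powi_mult: "W t powi m * W t powi n = W t powi (m + n)"
  by (simp add: W_powi cis_mult algebra_simps)

text \<open>The partial sums over finite index sets converge uniformly on the unit interval, so the
  integral passes to the limit; by orthogonality their integrals are constantly \<open>c m u\<close>
  once the set contains m.\<close>

lemma W_coeff_synth:
  assumes "rapid c"
  shows "W_coeff (synth c) = c"
proof (intro ext)
  fix m u
  obtain B where B: "\<And>k x. norm (c k x) \<le> B * int_decay k"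
    using rapid_norm_le_decay[OF assms] by blast
  let ?F = "finite_subsets_at_top (UNIV :: int set)"
  let ?f = "\<lambda>X t. \<Sum>n\<in>X. c n u * W t powi (n - m)"
  have "uniform_limit {0..1} ?f (\<lambda>t. \<Sum>\<^sub>\<infinity>n\<in>UNIV. c n u * W t powi (n - m)) ?F"
    by (rule Weierstrass_m_test_general[OF _ summable_int_decay_scaled])
      (use B in \<open>auto simp: norm_mult norm_W_powi\<close>)
  moreover have "continuous_on {0..1} (?f X)" for X
    by (intro continuous_intros)
  ultimately obtain I J where I: "\<And>X. (?f X has_integral I X) {0..1}"
    and J: "((\<lambda>t. \<Sum>\<^sub>\<infinity>n\<in>UNIV. c n u * W t powi (n - m)) has_integral J) {0..1}"
    and lim: "(I \<longlongrightarrow> J) ?F"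
    by (rule uniform_limit_integral) auto
  have "I X = c m u" if "finite X" "m \<in> X" for X
  proof -
    have "(?f X has_integral (\<Sum>n\<in>X. c n u * (if n - m = 0 then 1 else 0))) {0..1}"
      using that by (intro has_integral_sum has_integral_mult_right integral_W_powi)
    also have "(\<Sum>n\<in>X. c n u * (if n - m = 0 then 1 else 0)) = c m u"
      using that by (simp add: if_distrib sum.If_cases cong: if_cong)
    finally show ?thesis
      using I has_integral_unique by blast
  qed
  then have "\<forall>\<^sub>F X in ?F. I X = c m u"
    unfolding eventually_finite_subsets_at_top by (intro exI[of _ "{m}"]) auto
  then have "(I \<longlongrightarrow> c m u) ?F"
    by (rule tendsto_eventually)
  with lim have "J = c m u"
    using tendsto_unique[OF finite_subsets_at_top_neq_bot] by blast
  moreover have "synth c (u, t) * W t powi (- m) = (\<Sum>\<^sub>\<infinity>n\<in>UNIV. c n u * W t powi (n - m))" for t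
    by (simp add: synth_def infsum_cmult_left'[symmetric] mult.assoc W_powi_mult)
  ultimately show "W_coeff (synth c) m u = c m u"
    using J by (simp add: W_coeff_def integral_unique)
qed

section \<open>Fourier coefficients\<close>

lemma has_vector_derivative_dir_deriv:
  fixes f :: "real \<times> real \<Rightarrow> complex"
  assumes "smooth f"
  shows "((\<lambda>u. f (u, t)) has_vector_derivative dir_deriv (1, 0) f (u, t)) (at u)"
    and "((\<lambda>t. f (u, t)) has_vector_derivative dir_deriv (0, 1) f (u, t)) (at t)"
proof -
  let ?D = "frechet_derivative f (at (u, t))"
  have der: "(f has_derivative ?D) (at (u, t))"
    using smooth_differentiable[OF assms] by (simp add: frechet_derivative_works)
  have scale: "?D (s *\<^sub>R v) = s *\<^sub>R ?D v" for s v
    using has_derivative_bounded_linear[OF der] by (rule linear_simps(5))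
  have "((\<lambda>u. (u, t)) has_derivative (\<lambda>s. s *\<^sub>R (1, 0))) (at u)"
    by (auto intro!: derivative_eq_intros)
  from has_derivative_compose[OF this der]
  show "((\<lambda>u. f (u, t)) has_vector_derivative dir_deriv (1, 0) f (u, t)) (at u)"
    unfolding has_vector_derivative_def dir_deriv_def scale .
  have "((\<lambda>t. (u, t)) has_derivative (\<lambda>s. s *\<^sub>R (0, 1))) (at t)"
    by (auto intro!: derivative_eq_intros)
  from has_derivative_compose[OF this der]
  show "((\<lambda>t. f (u, t)) has_vector_derivative dir_deriv (0, 1) f (u, t)) (at t)"
    unfolding has_vector_derivative_def dir_deriv_def scale .
qed

lemma smooth_dir_deriv_cylinder:
  assumes "smooth (f :: real \<times> real \<Rightarrow> complex)"
  shows "smooth (dir_deriv (1, 0) f)" "smooth (dir_deriv (0, 1) f)"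
  using assms by (auto intro!: smooth_dir_deriv simp: Basis_prod_def)

lemma smooth_continuous_slice:
  fixes f :: "real \<times> real \<Rightarrow> complex"
  assumes "smooth f"
  shows "continuous_on S (\<lambda>t. f (u, t))"
  by (rule continuous_on_compose2[OF smooth_continuous[OF assms]]) (auto intro!: continuous_intros)

text \<open>Differentiation under the integral sign, justified by continuity of the partial
  derivative over the compact interval.\<close>

lemma W_coeff_has_vector_derivative:
  assumes f: "smooth f"
  shows "(W_coeff f n has_vector_derivative W_coeff (dir_deriv (1, 0) f) n u) (at u)"
proof -
  have "((\<lambda>u. integral (cbox 0 1) (\<lambda>t. f (u, t) * W t powi (- n))) has_vector_derivative
      integral (cbox 0 1) (\<lambda>t. dir_deriv (1, 0) f (u, t) * W t powi (- n))) (at u within UNIV)"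
  proof (rule leibniz_rule_vector_derivative)
    show "((\<lambda>u. f (u, t) * W t powi (- n)) has_vector_derivative
        dir_deriv (1, 0) f (u, t) * W t powi (- n)) (at u within UNIV)" for u t
      using has_vector_derivative_dir_deriv(1)[OF f]
      by (auto intro!: has_vector_derivative_mult_left)
    show "(\<lambda>t. f (u, t) * W t powi (- n)) integrable_on cbox 0 1" for u
      by (intro integrable_continuous continuous_intros smooth_continuous_slice f)
    have "continuous_on UNIV (dir_deriv (1, 0) f)"
      by (rule smooth_continuous[OF smooth_dir_deriv_cylinder(1)[OF f]])
    then show "continuous_on (UNIV \<times> cbox 0 1) (\<lambda>(u, t). dir_deriv (1, 0) f (u, t) * W t powi (- n))"
      unfolding W_powi case_prod_beta prod.collapse
      by (intro continuous_intros) (auto intro: continuous_on_subset)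
  qed auto
  then show ?thesis
    by (simp add: W_coeff_def[abs_def])
qed

text \<open>Integration by parts; periodicity cancels the boundary terms.\<close>

lemma W_coeff_dir_deriv_circle:
  assumes f: "smooth f" and per: "\<And>u t. f (u, t + 1) = f (u, t)"
  shows "W_coeff (dir_deriv (0, 1) f) n u = 2 * pi * \<i> * of_int n * W_coeff f n u"
proof -
  have "((\<lambda>t. f (u, t) * (2 * pi * \<i> * of_int (- n) * W t powi (- n)) + dir_deriv (0, 1) f (u, t) * W t powi (- n))
      has_integral f (u, 1) * W 1 powi (- n) - f (u, 0) * W 0 powi (- n)) {0..1}"
    by (rule fundamental_theorem_of_calculus[OF _ has_vector_derivative_at_within
          [OF has_vector_derivative_mult[OF has_vector_derivative_dir_deriv(2)[OF f] W_powi_vector_derivative]]])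
      simp
  also have "f (u, 1) * W 1 powi (- n) - f (u, 0) * W 0 powi (- n) = 0"
    using per[of u 0] W_periodic[of 0] by simp
  finally have "integral {0..1} (\<lambda>t. f (u, t) * (2 * pi * \<i> * of_int (- n) * W t powi (- n))
      + dir_deriv (0, 1) f (u, t) * W t powi (- n)) = 0"
    by (rule integral_unique)
  also have "(\<lambda>t. f (u, t) * (2 * pi * \<i> * of_int (- n) * W t powi (- n))
      + dir_deriv (0, 1) f (u, t) * W t powi (- n))
      = (\<lambda>t. - (2 * pi * \<i> * of_int n) * (f (u, t) * W t powi (- n)) + dir_deriv (0, 1) f (u, t) * W t powi (- n))"
    by (simp add: mult_ac del: power_int_minus)
  also have "integral {0..1} \<dots> = - (2 * pi * \<i> * of_int n) * W_coeff f n u + W_coeff (dir_deriv (0, 1) f) n u"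
    unfolding W_coeff_def
    by (subst integral_add) (auto intro!: integrable_continuous_real continuous_intros
        smooth_continuous_slice f smooth_dir_deriv_cylinder(2))
  finally show ?thesis
    by (simp add: algebra_simps)
qed

text \<open>Allows the integration by parts to be iterated. The slices at t and t + 1 are the same
  function, so uniqueness of derivatives applies.\<close>

lemma dir_deriv_circle_periodic:
  fixes f :: "real \<times> real \<Rightarrow> complex"
  assumes f: "smooth f" and per: "\<And>u t. f (u, t + 1) = f (u, t)"
  shows "dir_deriv (0, 1) f (u, t + 1) = dir_deriv (0, 1) f (u, t)"
proof -
  have "((\<lambda>t. t + 1) has_vector_derivative 1) (at (t :: real))"
    by (auto intro!: derivative_eq_intros)
  from vector_diff_chain_at[OF this has_vector_derivative_dir_deriv(2)[OF f]]
  have "((\<lambda>t. f (u, t)) has_vector_derivative dir_deriv (0, 1) f (u, t + 1)) (at t)"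
    by (simp add: o_def per)
  with has_vector_derivative_dir_deriv(2)[OF f, of u t] show ?thesis
    by (rule vector_derivative_unique_at[symmetric])
qed

lemma dir_deriv_scale:
  assumes "smooth (g :: real \<Rightarrow> complex)"
  shows "(dir_deriv 1 ^^ b) (\<lambda>u. z * g u) = (\<lambda>u. z * (dir_deriv 1 ^^ b) g u)"
  using assms
proof (induction b arbitrary: g)
  case (Suc b)
  have "dir_deriv 1 (\<lambda>u. z * g u) = (\<lambda>u. z * dir_deriv 1 g u)"
    by (rule dir_deriv_1_eq) (intro has_vector_derivative_mult_right smooth_vector_derivative Suc.prems)
  moreover have "smooth (dir_deriv 1 g)"
    using Suc.prems by (simp add: smooth_dir_deriv)
  ultimately show ?case
    using Suc.IH by (simp add: funpow_Suc_right del: funpow.simps)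
qed simp

lemma smooth_W_coeff:
  assumes "smooth f"
  shows "smooth (W_coeff f n)"
proof -
  define X where "X g \<longleftrightarrow> (\<exists>f. smooth f \<and> g = W_coeff f n)" for g
  have "X (W_coeff f n)"
    using assms X_def by blast
  then show ?thesis
  proof (rule smooth_coinduct)
    fix g assume "X g"
    then obtain f where f: "smooth f" "g = W_coeff f n"
      by (auto simp: X_def)
    have der: "(g has_vector_derivative W_coeff (dir_deriv (1, 0) f) n u) (at u)" for u
      unfolding f(2) by (rule W_coeff_has_vector_derivative[OF f(1)])
    have "X (W_coeff (dir_deriv (1, 0) f) n)"
      using smooth_dir_deriv_cylinder(1)[OF f(1)] X_def by blast
    then show "g differentiable_on UNIV \<and> (\<forall>v\<in>Basis. X (dir_deriv v g))"
      using dir_deriv_1_eq[OF der] der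
      by (auto intro!: differentiableI_vector simp: differentiable_on_eq_differentiable_at)
  qed
qed

text \<open>Regularity along the circle becomes decay in n: (2 pi i n)^m times a coefficient is the
  coefficient of the m-th circle derivative, and a coefficient is bounded by the supremum over the
  circle. Derivatives along the line pass through the integral.\<close>

lemma rapid_W_coeff:
  assumes "f \<in> schwartz_cylinder"
  shows "rapid (W_coeff f)"
proof -
  have f: "smooth f" "\<And>u t. f (u, t + 1) = f (u, t)"
    and bd: "\<And>a b c. \<exists>B. \<forall>u t. \<bar>u\<bar> ^ a * norm ((dir_deriv (1, 0) ^^ b) ((dir_deriv (0, 1) ^^ c) f) (u, t)) \<le> B"
    using assms by (auto simp: schwartz_cylinder_def)
  have du: "smooth ((dir_deriv (1, 0) ^^ b) g) \<and>
      (dir_deriv 1 ^^ b) (W_coeff g n) = W_coeff ((dir_deriv (1, 0) ^^ b) g) n" if "smooth g" for b n g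
    using that
  proof (induction b)
    case (Suc b)
    have "dir_deriv 1 (W_coeff ((dir_deriv (1, 0) ^^ b) g) n)
        = W_coeff (dir_deriv (1, 0) ((dir_deriv (1, 0) ^^ b) g)) n"
      using Suc by (intro dir_deriv_1_eq W_coeff_has_vector_derivative) auto
    with Suc show ?case
      by (auto intro: smooth_dir_deriv_cylinder)
  qed simp
  have dt: "smooth ((dir_deriv (0, 1) ^^ m) f) \<and>
      (\<forall>u t. (dir_deriv (0, 1) ^^ m) f (u, t + 1) = (dir_deriv (0, 1) ^^ m) f (u, t)) \<and>
      W_coeff ((dir_deriv (0, 1) ^^ m) f) n = (\<lambda>u. (2 * pi * \<i> * of_int n) ^ m * W_coeff f n u)" for m n
  proof (induction m)
    case (Suc m)
    then show ?case
      using smooth_dir_deriv_cylinder(2) dir_deriv_circle_periodic W_coeff_dir_deriv_circle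
      by (auto simp: fun_eq_iff mult.assoc)
  qed (use f in auto)
  have "\<exists>B. \<forall>u n. \<bar>u\<bar> ^ a * \<bar>of_int n\<bar> ^ m * norm ((dir_deriv 1 ^^ b) (W_coeff f n) u) \<le> B" for a b m
  proof -
    let ?g = "(dir_deriv (1, 0) ^^ b) ((dir_deriv (0, 1) ^^ m) f)"
    have g: "smooth ?g"
      using du dt by blast
    obtain B where B: "\<And>u t. \<bar>u\<bar> ^ a * norm (?g (u, t)) \<le> B"
      using bd by blast
    have "\<bar>u\<bar> ^ a * \<bar>of_int n\<bar> ^ m * norm ((dir_deriv 1 ^^ b) (W_coeff f n) u) \<le> B" for u n
    proof -
      have "(2 * pi * \<i> * of_int n) ^ m * (dir_deriv 1 ^^ b) (W_coeff f n) u
          = (dir_deriv 1 ^^ b) (W_coeff ((dir_deriv (0, 1) ^^ m) f) n) u"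
        using dt[of m n] dir_deriv_scale[OF smooth_W_coeff[OF f(1)]] by simp
      also have "\<dots> = W_coeff ?g n u"
        by (rule fun_cong[OF conjunct2[OF du[OF conjunct1[OF dt]]]])
      finally have eq: "(2 * pi * \<i> * of_int n) ^ m * (dir_deriv 1 ^^ b) (W_coeff f n) u = W_coeff ?g n u" .
      \<comment> \<open>The identity for the coefficients carries powers of 2 pi |n|, which dominate
        those of |n| because 2 pi is at least 1.\<close>
      have "\<bar>of_int n\<bar> ^ m \<le> (2 * pi * \<bar>of_int n\<bar>) ^ m"
        using pi_ge_two mult_right_mono[of 1 "2 * pi" "\<bar>of_int n\<bar>"] by (intro power_mono) auto
      then have "\<bar>u\<bar> ^ a * (\<bar>of_int n\<bar> ^ m * norm ((dir_deriv 1 ^^ b) (W_coeff f n) u))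
          \<le> \<bar>u\<bar> ^ a * ((2 * pi * \<bar>of_int n\<bar>) ^ m * norm ((dir_deriv 1 ^^ b) (W_coeff f n) u))"
        by (intro mult_left_mono mult_right_mono) auto
      also have "(2 * pi * \<bar>of_int n\<bar>) ^ m * norm ((dir_deriv 1 ^^ b) (W_coeff f n) u) = norm (W_coeff ?g n u)"
        unfolding eq[symmetric] by (simp add: norm_mult norm_power)
      also have "\<bar>u\<bar> ^ a * norm (W_coeff ?g n u)
          = norm (integral {0..1} (\<lambda>t. of_real (\<bar>u\<bar> ^ a) * (?g (u, t) * W t powi (- n))))"
        by (simp add: W_coeff_def norm_mult norm_power)
      \<comment> \<open>Powers of \<open>W\<close> have modulus 1, so B bounds the integrand; the
        other factor is the length of the interval.\<close>
      also have "\<dots> \<le> B * (1 - 0)"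
        using B
        by (intro integral_bound continuous_intros smooth_continuous_slice g)
          (auto simp: norm_mult norm_W_powi norm_power simp del: power_int_minus)
      finally show ?thesis
        by (simp add: mult.assoc)
    qed
    then show ?thesis
      by blast
  qed
  then have "(\<lambda>(u, n). W_coeff f n u) \<in> schwartz_line_int"
    using smooth_W_coeff[OF f(1)] by (simp add: schwartz_line_int_def)
  then show ?thesis
    by (simp add: schwartz_line_int_iff_rapid)
qed

section \<open>Uniqueness of the Fourier expansion\<close>

text \<open>The last term stays a product because, for a trigonometric polynomial b, it is
  integrated as \<open>b * cnj b\<close> by orthogonality.\<close>

lemma norm_diff_square_eq:
  "(norm (a - b))\<^sup>2 = (norm a)\<^sup>2 - 2 * Re (a * cnj b) + Re (b * cnj b)"
  unfolding cmod_power2 by (simp add: power2_eq_square algebra_simps)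

text \<open>With P the trigonometric polynomial with coefficients \<open>c\<close>, both h times the
  conjugate of P and |P|^2 integrate to the sum S. Integrating |h - P|^2 therefore gives 0 <= I - 2
  S + S, where I is the integral of |h|^2.\<close>

lemma Bessel_inequality:
  fixes h :: "real \<Rightarrow> complex"
  assumes h: "continuous_on {0..1} h" and "finite A"
    and c: "\<And>n. n \<in> A \<Longrightarrow> ((\<lambda>t. h t * W t powi (- n)) has_integral c n) {0..1}"
  shows "(\<Sum>n\<in>A. (norm (c n))\<^sup>2) \<le> integral {0..1} (\<lambda>t. (norm (h t))\<^sup>2)"
proof -
  define P where "P t = (\<Sum>n\<in>A. c n * W t powi n)" for t
  define S where "S = (\<Sum>n\<in>A. (norm (c n))\<^sup>2)"
  have cnj_W: "cnj (W t powi n) = W t powi (- n)" for t n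
    unfolding W_powi by (simp add: cis_cnj)
  have cnj_P: "cnj (P t) = (\<Sum>n\<in>A. cnj (c n) * W t powi (- n))" for t
    by (simp only: P_def cnj_sum complex_cnj_mult cnj_W)
  have S: "of_real S = (\<Sum>n\<in>A. cnj (c n) * c n)"
    unfolding S_def of_real_sum
    by (simp add: complex_norm_square mult.commute del: of_real_power)
  have hP: "((\<lambda>t. h t * cnj (P t)) has_integral of_real S) {0..1}"
  proof -
    have "((\<lambda>t. \<Sum>n\<in>A. cnj (c n) * (h t * W t powi (- n))) has_integral (\<Sum>n\<in>A. cnj (c n) * c n)) {0..1}"
      by (intro has_integral_sum has_integral_mult_right c \<open>finite A\<close>)
    then show ?thesis
      by (simp add: cnj_P S sum_distrib_left mult_ac del: power_int_minus)
  qed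
  have PP: "((\<lambda>t. P t * cnj (P t)) has_integral of_real S) {0..1}"
  proof -
    have "((\<lambda>t. \<Sum>m\<in>A. cnj (c m) * (\<Sum>n\<in>A. c n * W t powi (n - m))) has_integral
        (\<Sum>m\<in>A. cnj (c m) * (\<Sum>n\<in>A. c n * (if n - m = 0 then 1 else 0)))) {0..1}"
      by (intro has_integral_sum has_integral_mult_right integral_W_powi \<open>finite A\<close>)
    moreover have "(\<Sum>m\<in>A. cnj (c m) * (\<Sum>n\<in>A. c n * (if n - m = 0 then 1 else 0))) = of_real S"
      unfolding S using \<open>finite A\<close>
      by (intro sum.cong refl) (simp add: if_distrib sum.If_cases cong: if_cong)
    moreover have "(\<Sum>m\<in>A. cnj (c m) * (\<Sum>n\<in>A. c n * W t powi (n - m))) = P t * cnj (P t)" for t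
    proof -
      have "P t * cnj (P t) = (\<Sum>m\<in>A. cnj (c m) * (\<Sum>n\<in>A. c n * (W t powi n * W t powi (- m))))"
        unfolding cnj_P unfolding P_def sum_distrib_left sum_distrib_right
        by (simp add: mult_ac del: power_int_minus)
      then show ?thesis
        unfolding W_powi_mult by simp
    qed
    ultimately show ?thesis
      by simp
  qed
  have hh: "((\<lambda>t. (norm (h t))\<^sup>2) has_integral integral {0..1} (\<lambda>t. (norm (h t))\<^sup>2)) {0..1}"
    by (intro integrable_integral integrable_continuous_real continuous_intros h)
  have "((\<lambda>t. (norm (h t))\<^sup>2 - 2 * Re (h t * cnj (P t)) + Re (P t * cnj (P t))) has_integral
      integral {0..1} (\<lambda>t. (norm (h t))\<^sup>2) - 2 * Re (of_real S) + Re (of_real S)) {0..1}"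
    by (intro has_integral_add has_integral_diff has_integral_mult_right hh has_integral_Re hP PP)
  moreover have "(norm (h t))\<^sup>2 - 2 * Re (h t * cnj (P t)) + Re (P t * cnj (P t)) = (norm (h t - P t))\<^sup>2" for t
    by (rule norm_diff_square_eq[symmetric])
  ultimately have "((\<lambda>t. (norm (h t - P t))\<^sup>2) has_integral
      integral {0..1} (\<lambda>t. (norm (h t))\<^sup>2) - 2 * Re (of_real S) + Re (of_real S)) {0..1}"
    by simp
  then have "0 \<le> integral {0..1} (\<lambda>t. (norm (h t))\<^sup>2) - 2 * Re (of_real S) + Re (of_real S)"
    by (rule has_integral_nonneg) simp
  then show ?thesis
    by (simp add: S_def)
qed

text \<open>N coefficients of modulus a contribute N a^2 to a sum bounded by one fixed integral,
  which fails for large N unless a = 0.\<close>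

lemma Fourier_coeff_constant_norm_zero:
  fixes h :: "real \<Rightarrow> complex"
  assumes h: "continuous_on {0..1} h" and "infinite A"
    and c: "\<And>n. n \<in> A \<Longrightarrow> ((\<lambda>t. h t * W t powi (- n)) has_integral c n) {0..1}"
    and a: "\<And>n. n \<in> A \<Longrightarrow> norm (c n) = a"
  shows "a = 0"
proof (rule ccontr)
  assume "a \<noteq> 0"
  let ?I = "integral {0..1} (\<lambda>t. (norm (h t))\<^sup>2)"
  obtain N where N: "?I < real N * a\<^sup>2"
    using reals_Archimedean3[of "a\<^sup>2"] \<open>a \<noteq> 0\<close> by auto
  obtain F where F: "F \<subseteq> A" "finite F" "card F = N"
    using infinite_arbitrarily_large[OF \<open>infinite A\<close>] by metis
  have "(\<Sum>n\<in>F. (norm (c n))\<^sup>2) \<le> ?I"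
    using F c by (intro Bessel_inequality h) auto
  also have "(\<Sum>n\<in>F. (norm (c n))\<^sup>2) = (\<Sum>n\<in>F. a\<^sup>2)"
    using F(1) a by (intro sum.cong) auto
  finally show False
    using N F by simp
qed

text \<open>Lets the quotient of two increments of functions of a real variable tend to the quotient
  of their derivatives, as needed where a denominator vanishes.\<close>

lemma tendsto_difference_quotient:
  fixes g :: "real \<Rightarrow> complex"
  assumes "(g has_vector_derivative D) (at s)"
  shows "((\<lambda>t. (g t - g s) / of_real (t - s)) \<longlongrightarrow> D) (at s)"
proof -
  have lim: "((\<lambda>t. norm ((1 / norm (t - s)) *\<^sub>R (g t - (g s + (t - s) *\<^sub>R D)))) \<longlongrightarrow> 0) (at s)"
    using assms unfolding has_vector_derivative_def has_derivative_within
    by (auto dest: tendsto_norm_zero)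
  have "((\<lambda>t. (g t - g s) / of_real (t - s) - D) \<longlongrightarrow> 0) (at s)"
  proof (rule Lim_null_comparison[OF _ lim])
    have "norm ((g t - g s) / of_real (t - s) - D)
        \<le> norm ((1 / norm (t - s)) *\<^sub>R (g t - (g s + (t - s) *\<^sub>R D)))" if "t \<noteq> s" for t
    proof -
      have "(g t - g s) / of_real (t - s) - D = (g t - (g s + (t - s) *\<^sub>R D)) / of_real (t - s)"
        using that by (simp add: field_simps scaleR_conv_of_real)
      then show ?thesis
        by (simp add: norm_divide flip: of_real_diff)
    qed
    then show "\<forall>\<^sub>F t in at s. norm ((g t - g s) / of_real (t - s) - D)
        \<le> norm ((1 / norm (t - s)) *\<^sub>R (g t - (g s + (t - s) *\<^sub>R D)))"
      by (auto simp: eventually_at_filter)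
  qed
  then show ?thesis
    by (rule LIM_zero_cancel)
qed

lemma W_eq_iff: "W t = W s \<longleftrightarrow> (\<exists>n::int. t = s + of_int n)"
proof -
  have "W t = W s \<longleftrightarrow> (\<exists>n::int. 2 * pi * \<i> * t = 2 * pi * \<i> * s + (of_int (2 * n) * pi) * \<i>)"
    by (simp add: W_def exp_eq)
  also have "\<dots> \<longleftrightarrow> (\<exists>n::int. t = s + of_int n)"
  proof (intro iff_exI)
    fix n :: int
    have "2 * pi * \<i> * t - (2 * pi * \<i> * s + (of_int (2 * n) * pi) * \<i>) = 2 * pi * \<i> * of_real (t - (s + of_int n))"
      by (simp add: algebra_simps)
    then show "2 * pi * \<i> * t = 2 * pi * \<i> * s + (of_int (2 * n) * pi) * \<i> \<longleftrightarrow> t = s + of_int n"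
      by (metis (no_types, lifting) complex_i_not_zero eq_iff_diff_eq_0 mult_eq_0_iff of_real_eq_0_iff
          pi_neq_zero zero_neq_numeral)
  qed
  finally show ?thesis .
qed

lemma periodic_of_int:
  assumes "\<And>t. g (t + 1) = g (t :: real)"
  shows "g (t + of_int n) = g t"
proof -
  interpret periodic_fun_simple' g
    by unfold_locales (rule assms)
  show ?thesis
    by (rule plus_of_int)
qed

text \<open>Chernoff's argument: the quotient \<open>(g - g(s)) / (W - W(s))\<close> is continuous, and its Fourier
  coefficients all have the same modulus on each of the two half-lines of indices, since those of
  its numerator vanish off index 0; by Bessel's inequality they are 0.\<close>

lemma Fourier_uniqueness:
  fixes g :: "real \<Rightarrow> complex"
  assumes der: "\<And>t. (g has_vector_derivative g' t) (at t)"
    and per: "\<And>t. g (t + 1) = g t"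
    and zero: "\<And>n. ((\<lambda>t. g t * W t powi (- n)) has_integral 0) {0..1}"
  shows "g s = 0"
proof -
  \<comment> \<open>The first branch fills the removable singularities with g' / W'. Its condition
    is \<open>W t = W s\<close> rather than t = s, because the denominator vanishes at all integer
    translates of s.\<close>
  define h where "h t = (if W t = W s then g' t / (2 * pi * \<i> * W t) else (g t - g s) / (W t - W s))" for t
  have W_der: "(W has_vector_derivative 2 * pi * \<i> * W t) (at t)" for t
    using W_powi_vector_derivative[of 1 t] by simp
  have W_nz: "W t \<noteq> 0" for t
    by (simp add: W_def)
  have cont_g: "isCont g t" for t
    using der has_vector_derivative_continuous by blast
  have cont_W: "isCont W t" for t
    using W_der has_vector_derivative_continuous by blast
  have eq_g: "g t = g s" if "W t = W s" for t
    using that periodic_of_int[of g, OF per] by (auto simp: W_eq_iff)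
  have "isCont h t" for t
  proof (cases "W t = W s")
    case True
    have "((\<lambda>r. ((g r - g t) / of_real (r - t)) / ((W r - W t) / of_real (r - t))) \<longlongrightarrow>
        g' t / (2 * pi * \<i> * W t)) (at t)"
      using W_nz by (intro tendsto_divide tendsto_difference_quotient der W_der) auto
    moreover have "\<forall>\<^sub>F r in at t. ((g r - g t) / of_real (r - t)) / ((W r - W t) / of_real (r - t)) = h r"
      unfolding eventually_at
    \<comment> \<open>Radius 1 is one period: closer than that, \<open>W\<close> takes the value
      \<open>W t\<close> only at t.\<close>
    proof (intro exI[of _ 1] conjI ballI impI)
      fix r assume r: "r \<noteq> t \<and> dist r t < 1"
      have "W r \<noteq> W t"
        using r by (auto simp: W_eq_iff dist_real_def)
      with r True eq_g[OF True] show "((g r - g t) / of_real (r - t)) / ((W r - W t) / of_real (r - t)) = h r"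
        by (auto simp: h_def)
    qed simp
    ultimately have "(h \<longlongrightarrow> g' t / (2 * pi * \<i> * W t)) (at t)"
      by (rule Lim_transform_eventually)
    with True show ?thesis
      by (simp add: isCont_def h_def)
  next
    case False
    have cont: "isCont (\<lambda>t. (g t - g s) / (W t - W s)) t"
      using False by (intro continuous_intros cont_g cont_W) auto
    have "\<forall>\<^sub>F r in nhds t. W r \<noteq> W s"
      using cont_W[of t] False by (metis isCont_def tendsto_at_iff_tendsto_nhds tendsto_imp_eventually_ne)
    then have "\<forall>\<^sub>F r in nhds t. (g r - g s) / (W r - W s) = h r"
      by eventually_elim (simp add: h_def)
    from isCont_cong[OF this] cont show ?thesis
      by simp
  qed
  then have h: "continuous_on {0..1} h"
    by (simp add: continuous_at_imp_continuous_on)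
  define c where "c n = integral {0..1} (\<lambda>t. h t * W t powi (- n))" for n
  have c: "((\<lambda>t. h t * W t powi (- n)) has_integral c n) {0..1}" for n
    unfolding c_def by (intro integrable_integral integrable_continuous_real continuous_intros h)
  \<comment> \<open>Compares the n-th coefficients in (W - W(s)) h = g - g(s). Multiplication by
    \<open>W\<close> shifts the index by one, all coefficients of g vanish, and the constant g(s)
    contributes only at n = 0.\<close>
  have rec: "c (n - 1) - W s * c n = - g s * (if n = 0 then 1 else 0)" for n
  proof -
    have int_h: "((\<lambda>t. h t * W t powi (- (n - 1)) - W s * (h t * W t powi (- n))) has_integral c (n - 1) - W s * c n) {0..1}"
      by (intro has_integral_diff has_integral_mult_right c)
    have int_g: "((\<lambda>t. g t * W t powi (- n) - g s * W t powi (- n)) has_integral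
        0 - g s * (if - n = 0 then 1 else 0)) {0..1}"
      by (intro has_integral_diff has_integral_mult_right zero integral_W_powi)
    have eq: "h t * W t powi (- (n - 1)) - W s * (h t * W t powi (- n))
        = g t * W t powi (- n) - g s * W t powi (- n)" for t
    proof -
      have shift: "W t powi (- (n - 1)) = W t * W t powi (- n)"
        using W_powi_mult[of t 1 "- n"] by (simp del: power_int_minus)
      have "h t * W t powi (- (n - 1)) - W s * (h t * W t powi (- n)) = h t * (W t - W s) * W t powi (- n)"
        unfolding shift by (simp only: left_diff_distrib right_diff_distrib mult_ac)
      also have "h t * (W t - W s) = g t - g s"
        using eq_g[of t] by (cases "W t = W s") (simp_all add: h_def)
      finally show ?thesis
        by (simp only: left_diff_distrib)
    qed
    show ?thesis
      using has_integral_unique[OF int_h[unfolded eq] int_g] by simp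
  qed
  have norm_W: "norm (W s) = 1"
    using norm_W_powi[of s 1] by simp
  have step: "norm (c (n - 1)) = norm (c n)" if "n \<noteq> 0" for n
    using rec[of n] that norm_W by (simp add: norm_mult)
  \<comment> \<open>The recursion preserves the modulus except across n = 0, so the chains start at
    0 going up and at -1 going down; \<open>rec\<close> at n = 0 later links these two starting
    coefficients to g(s).\<close>
  have pos: "norm (c (int k)) = norm (c 0)" for k
    by (induction k) (use step[of "int (Suc _)"] in auto)
  have neg: "norm (c (- 1 - int k)) = norm (c (- 1))" for k
  proof (induction k)
    case (Suc k)
    then show ?case
      using step[of "- 1 - int k"] by (simp add: algebra_simps)
  qed simp
  have "infinite (range int)"
    by (intro range_inj_infinite) simp
  then have "norm (c 0) = 0"
    by (rule Fourier_coeff_constant_norm_zero[OF h _ c]) (use pos in auto)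
  moreover have "infinite (range (\<lambda>k. - 1 - int k))"
    by (intro range_inj_infinite) (simp add: inj_on_def)
  then have "norm (c (- 1)) = 0"
    by (rule Fourier_coeff_constant_norm_zero[OF h _ c]) (use neg in auto)
  ultimately show ?thesis
    using rec[of 0] by simp
qed

section \<open>Fourier inversion on the cylinder\<close>

lemma schwartz_cylinder_smooth: "f \<in> schwartz_cylinder \<Longrightarrow> smooth f"
  and schwartz_cylinder_periodic: "f \<in> schwartz_cylinder \<Longrightarrow> f (u, t + 1) = f (u, t)"
  by (auto simp: schwartz_cylinder_def)

lemma W_coeff_has_integral:
  assumes "f \<in> schwartz_cylinder"
  shows "((\<lambda>t. f (u, t) * W t powi (- n)) has_integral W_coeff f n u) {0..1}"
  unfolding W_coeff_def
  by (intro integrable_integral integrable_continuous_real continuous_intros smooth_continuous_slice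
      schwartz_cylinder_smooth assms)

text \<open>Uniqueness is applied to the difference on each slice of fixed u. Identities between
  Schwartz functions can then be checked on coefficients.\<close>

lemma W_coeff_inject:
  assumes f: "f \<in> schwartz_cylinder" and g: "g \<in> schwartz_cylinder" and eq: "W_coeff f = W_coeff g"
  shows "f = g"
proof
  fix p :: "real \<times> real"
  obtain u s where p: "p = (u, s)"
    by (cases p)
  have "f (u, s) - g (u, s) = 0"
  proof (rule Fourier_uniqueness[where g = "\<lambda>t. f (u, t) - g (u, t)"])
    show "((\<lambda>t. f (u, t) - g (u, t)) has_vector_derivative
        dir_deriv (0, 1) f (u, t) - dir_deriv (0, 1) g (u, t)) (at t)" for t
      by (intro has_vector_derivative_diff has_vector_derivative_dir_deriv(2) schwartz_cylinder_smooth f g)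
    show "((\<lambda>t. (f (u, t) - g (u, t)) * W t powi (- n)) has_integral 0) {0..1}" for n
      using has_integral_diff[OF W_coeff_has_integral[OF f] W_coeff_has_integral[OF g], of u n u n] eq
      by (simp add: left_diff_distrib del: power_int_minus)
  qed (simp add: schwartz_cylinder_periodic f g)
  then show "f p = g p"
    by (simp add: p)
qed

text \<open>Both sides are Schwartz functions and have the same coefficients by
  \<open>W_coeff_synth\<close>, so inversion follows from uniqueness.\<close>

lemma synth_W_coeff: "f \<in> schwartz_cylinder \<Longrightarrow> synth (W_coeff f) = f"
  by (intro W_coeff_inject synth_in_cylinder rapid_W_coeff W_coeff_synth)

lemma W_coeff_add:
  assumes f: "f \<in> schwartz_cylinder" and g: "g \<in> schwartz_cylinder"
  shows "W_coeff (f + g) = (\<lambda>n u. W_coeff f n u + W_coeff g n u)"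
proof (intro ext)
  fix n u
  have "((\<lambda>t. (f + g) (u, t) * W t powi (- n)) has_integral W_coeff f n u + W_coeff g n u) {0..1}"
    using has_integral_add[OF W_coeff_has_integral[OF f] W_coeff_has_integral[OF g], of u n u n]
    by (simp add: distrib_right del: power_int_minus)
  then show "W_coeff (f + g) n u = W_coeff f n u + W_coeff g n u"
    unfolding W_coeff_def[of "f + g"] by (rule integral_unique)
qed

lemma W_coeff_pscale: "W_coeff (pscale z f) = (\<lambda>n u. z * W_coeff f n u)"
  by (simp add: W_coeff_def pscale_def mult.assoc fun_eq_iff del: power_int_minus)

section \<open>The algebra\<close>

lemma vector_space_pscale: "vector_space pscale"
  by unfold_locales (simp_all add: pscale_def fun_eq_iff algebra_simps)

lemma synth_add:
  assumes "rapid c" "rapid d"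
  shows "synth c + synth d = synth (\<lambda>n u. c n u + d n u)"
  using synth_summable[OF assms(1)] synth_summable[OF assms(2)]
  by (auto simp: synth_def fun_eq_iff distrib_right infsum_add)

lemma pscale_synth: "pscale z (synth c) = synth (\<lambda>n u. z * c n u)"
  by (auto simp: synth_def pscale_def fun_eq_iff mult.assoc infsum_cmult_right')

text \<open>By inversion the sum is \<open>synth\<close> of the added coefficients, so closure comes
  from that of rapid families instead of from iterated derivatives on the cylinder.\<close>

lemma schwartz_cylinder_add:
  assumes "f \<in> schwartz_cylinder" "g \<in> schwartz_cylinder"
  shows "f + g \<in> schwartz_cylinder"
  using synth_in_cylinder[OF rapid_add[OF rapid_W_coeff[OF assms(1)] rapid_W_coeff[OF assms(2)]]]
    synth_add[OF rapid_W_coeff[OF assms(1)] rapid_W_coeff[OF assms(2)]] assms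
  by (simp add: synth_W_coeff)

lemma schwartz_cylinder_pscale:
  assumes "f \<in> schwartz_cylinder"
  shows "pscale z f \<in> schwartz_cylinder"
  using synth_in_cylinder[OF rapid_scale[OF rapid_W_coeff[OF assms]], of z]
    pscale_synth[of z "W_coeff f"] assms
  by (simp add: synth_W_coeff)

lemma schwartz_cylinder_zero: "0 \<in> schwartz_cylinder"
  using synth_in_cylinder[OF rapid_zero] by (simp add: synth_def zero_fun_def case_prod_unfold)

lemma complex_subspace_cylinder: "complex_subspace pscale schwartz_cylinder"
proof -
  interpret vector_space "pscale :: complex \<Rightarrow> (real \<times> real \<Rightarrow> complex) \<Rightarrow> _"
    by (rule vector_space_pscale)
  show ?thesis
    by unfold_locales
      (auto simp: subspace_def schwartz_cylinder_zero schwartz_cylinder_add schwartz_cylinder_pscale)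
qed

lemma complex_subspace_line_int: "complex_subspace pscale schwartz_line_int"
proof -
  interpret vector_space "pscale :: complex \<Rightarrow> (real \<times> int \<Rightarrow> complex) \<Rightarrow> _"
    by (rule vector_space_pscale)
  show ?thesis
    by unfold_locales
      (auto simp: subspace_def schwartz_line_int_iff_rapid pscale_def rapid_zero
        intro: rapid_add rapid_scale)
qed

lemma C_mult_in_cylinder:
  "f \<in> schwartz_cylinder \<Longrightarrow> g \<in> schwartz_cylinder \<Longrightarrow> C_mult h f g \<in> schwartz_cylinder"
  unfolding C_mult_eq_synth by (intro synth_in_cylinder rapid_conv rapid_W_coeff)

lemma W_coeff_C_mult:
  "f \<in> schwartz_cylinder \<Longrightarrow> g \<in> schwartz_cylinder \<Longrightarrow>
    W_coeff (C_mult h f g) = conv h (W_coeff f) (W_coeff g)"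
  unfolding C_mult_eq_synth by (intro W_coeff_synth rapid_conv rapid_W_coeff)

text \<open>Each axiom is an equation between Schwartz functions; on coefficients it becomes the
  corresponding law of \<open>conv\<close>.\<close>

lemma assoc_algebra_cylinder: "assoc_algebra pscale schwartz_cylinder (C_mult h)"
proof -
  interpret complex_subspace pscale schwartz_cylinder
    by (rule complex_subspace_cylinder)
  note [simp] = C_mult_in_cylinder W_coeff_C_mult W_coeff_add W_coeff_pscale rapid_W_coeff
    schwartz_cylinder_add schwartz_cylinder_pscale
  show ?thesis
  proof unfold_locales
    fix a b c :: "real \<times> real \<Rightarrow> complex"
    assume [simp]: "a \<in> schwartz_cylinder" "b \<in> schwartz_cylinder"
    show "C_mult h a b \<in> schwartz_cylinder"
      by simp
    show "C_mult h (pscale z a) b = pscale z (C_mult h a b)" for z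
      by (rule W_coeff_inject) (simp_all add: conv_scale_left)
    show "C_mult h a (pscale z b) = pscale z (C_mult h a b)" for z
      by (rule W_coeff_inject) (simp_all add: conv_scale_right)
    assume [simp]: "c \<in> schwartz_cylinder"
    show "C_mult h (a + b) c = C_mult h a c + C_mult h b c"
      by (rule W_coeff_inject) (simp_all add: conv_add_left)
    show "C_mult h a (b + c) = C_mult h a b + C_mult h a c"
      by (rule W_coeff_inject) (simp_all add: conv_add_right)
    show "C_mult h (C_mult h a b) c = C_mult h a (C_mult h b c)"
      by (rule W_coeff_inject) (simp_all add: conv_assoc)
  qed
qed

section \<open>Free modules and transport of structure\<close>

lemma left_module_tuples:
  fixes sc :: "complex \<Rightarrow> 'a::ab_group_add \<Rightarrow> 'a" and mult :: "'a \<Rightarrow> 'a \<Rightarrow> 'a"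
  assumes "assoc_algebra sc A mult"
  shows "left_module sc A mult (tuple_scale sc) (tuples r A) (tuple_act r mult)"
proof -
  interpret assoc_algebra sc A mult
    by (rule assms)
  interpret tuple: vector_space "tuple_scale sc"
    by unfold_locales (simp_all add: tuple_scale_def fun_eq_iff scale_right_distrib scale_left_distrib)
  show ?thesis
    using subspace_0[OF subspace] subspace_add[OF subspace] subspace_scale[OF subspace]
    by unfold_locales
      (auto simp: tuple.subspace_def tuples_def tuple_scale_def tuple_act_def fun_eq_iff
        mult_closed mult_add_left mult_add_right mult_scale_left mult_scale_right mult_assoc)
qed

text \<open>Every element of \<open>N\<close> is some \<phi> m, and acting on it is \<phi> of acting
  on m. Each axiom on the target is thus the image of the axiom on the source.\<close>

lemma left_module_iso_transport:
  fixes mult :: "'a::ab_group_add \<Rightarrow> 'a \<Rightarrow> 'a"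
  assumes "left_module scaleA A mult scaleM M actM" and "complex_subspace scaleN N"
    and bij: "bij_betw \<phi> M N"
    and add: "\<And>m m'. m \<in> M \<Longrightarrow> m' \<in> M \<Longrightarrow> \<phi> (m + m') = \<phi> m + \<phi> m'"
    and scale: "\<And>m z. m \<in> M \<Longrightarrow> \<phi> (scaleM z m) = scaleN z (\<phi> m)"
    and act: "\<And>a m. a \<in> A \<Longrightarrow> m \<in> M \<Longrightarrow> \<phi> (actM a m) = actN a (\<phi> m)"
  shows "left_module_iso scaleA A mult scaleM M actM scaleN N actN \<phi>"
proof -
  interpret dom: left_module scaleA A mult scaleM M actM
    by (rule assms)
  interpret cod: complex_subspace scaleN N
    by (rule assms)
  have N: "N = \<phi> ` M"
    using bij by (simp add: bij_betw_def)
  have scale_M: "scaleM z m \<in> M" if "m \<in> M" for z m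
    using that by (rule dom.vec.subspace_scale[OF dom.vec.subspace])
  have add_M: "m + m' \<in> M" if "m \<in> M" "m' \<in> M" for m m'
    using that by (rule dom.vec.subspace_add[OF dom.vec.subspace])
  interpret cod: left_module scaleA A mult scaleN N actN
  proof unfold_locales
    fix a b z n n'
    assume a: "a \<in> A"
    assume "n \<in> N"
    then obtain m where m: "m \<in> M" "n = \<phi> m"
      by (auto simp: N)
    show "actN a n \<in> N"
      \<comment> \<open>Reading \<open>act\<close> from right to left pulls the target action inside
        \<phi>; the other axioms use the same rewriting.\<close>
      using a m by (auto simp: N simp flip: act intro: dom.act_closed)
    show "actN (scaleA z a) n = scaleN z (actN a n)"
      using a m dom.alg.subspace_scale[OF dom.alg.subspace]
      by (simp add: dom.act_closed dom.act_scale_left flip: act scale)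
    show "actN a (scaleN z n) = scaleN z (actN a n)"
      using a m scale_M by (simp add: dom.act_closed dom.act_scale_right flip: act scale)
    show "actN (mult a b) n = actN a (actN b n)" if "b \<in> A"
      using a m that by (simp add: dom.act_closed dom.alg.mult_closed dom.act_assoc flip: act)
    show "actN (a + b) n = actN a n + actN b n" if "b \<in> A"
      using a m that dom.alg.subspace_add[OF dom.alg.subspace]
      by (simp add: dom.act_closed dom.act_add_left flip: act add)
    assume "n' \<in> N"
    then obtain m' where m': "m' \<in> M" "n' = \<phi> m'"
      by (auto simp: N)
    then show "actN a (n + n') = actN a n + actN a n'"
      using a m add_M by (simp add: dom.act_closed dom.act_add_right flip: act add)
  qed
  show ?thesis
    by unfold_locales (use bij add scale act in auto)
qed

section \<open>The isomorphism\<close>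

lemma phi_at:
  assumes "i < r"
  shows "phi l0 l1 r F (x, n * int r + int i) = W_coeff (F i) n (l0 * x + l1 * of_int (n * int r + int i))"
  using assms by (simp add: phi_def)

text \<open>The weight at (x, k) is controlled by the weight at the new position and quotient: k
  differs from r times its quotient by less than r, and x is recovered from l0 x + l1 k because
  \<open>l0 \<noteq> 0\<close>.\<close>

lemma phi_in_line_int:
  assumes "r \<ge> 1" "l0 \<noteq> 0" and F: "F \<in> tuples r schwartz_cylinder"
  shows "phi l0 l1 r F \<in> schwartz_line_int"
proof -
  have "rapid (\<lambda>k x. W_coeff (F (nat (k mod int r))) (k div int r) (l0 * x + l1 * of_int k))"
  proof (rule rapid_reparam[where r = r and c = "\<lambda>i. W_coeff (F i)"])
    show "rapid (W_coeff (F i))" if "i < r" for i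
      using F that by (simp add: tuples_def rapid_W_coeff)
    show "nat (k mod int r) < r" for k
      using \<open>r \<ge> 1\<close> by (simp add: nat_less_iff)
    \<comment> \<open>\<open>?B\<close> bounds |k| through its quotient and remainder;
      \<open>?A\<close> arises from solving l0 x + l1 k for x and inserting the bound for k.\<close>
    let ?B = "real r" and ?A = "(1 + \<bar>l1\<bar> * real r) / \<bar>l0\<bar>"
    fix x k
    let ?w = "weight (l0 * x + l1 * of_int k) (k div int r)"
    have "\<bar>k\<bar> \<le> \<bar>(k div int r) * int r\<bar> + \<bar>k mod int r\<bar>"
      by (metis abs_triangle_ineq div_mult_mod_eq)
    also have "\<dots> \<le> int r * \<bar>k div int r\<bar> + int r"
      using \<open>r \<ge> 1\<close> less_imp_le[OF pos_mod_bound[of "int r" k]] by (simp add: abs_mult)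
    finally have "\<bar>k\<bar> \<le> int r * \<bar>k div int r\<bar> + int r" .
    then have "real_of_int \<bar>k\<bar> \<le> real_of_int (int r * \<bar>k div int r\<bar> + int r)"
      by (simp only: of_int_le_iff)
    then have "\<bar>real_of_int k\<bar> \<le> ?B * (1 + \<bar>of_int (k div int r)\<bar>)"
      by (simp add: distrib_left)
    also have "\<dots> \<le> ?B * ?w"
      by (intro mult_left_mono) (auto simp: weight_def)
    finally have k: "\<bar>real_of_int k\<bar> \<le> ?B * ?w" .
    have "\<bar>l0\<bar> * \<bar>x\<bar> = \<bar>(l0 * x + l1 * of_int k) - l1 * of_int k\<bar>"
      by (simp add: abs_mult)
    also have "\<dots> \<le> \<bar>l0 * x + l1 * of_int k\<bar> + \<bar>l1\<bar> * \<bar>of_int k\<bar>"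
      using abs_triangle_ineq4 by (metis abs_mult)
    also have "\<dots> \<le> ?w + \<bar>l1\<bar> * (?B * ?w)"
      by (intro add_mono mult_left_mono k) (auto simp: weight_def)
    finally have "\<bar>x\<bar> \<le> ?A * ?w"
      using \<open>l0 \<noteq> 0\<close> by (simp add: field_simps)
    with k weight_ge_1[of "l0 * x + l1 * of_int k" "k div int r"]
    \<comment> \<open>One summand each for the parts 1, |x| and |k| of the weight.\<close>
    show "weight x k \<le> (1 + ?A + ?B) * ?w"
      unfolding weight_def[of x k] distrib_right by linarith
  qed
  then show ?thesis
    by (simp add: schwartz_line_int_iff_rapid phi_def)
qed

lemma phi_inj_on:
  assumes "l0 \<noteq> 0"
  shows "inj_on (phi l0 l1 r) (tuples r schwartz_cylinder)"
proof (rule inj_onI)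
  fix F G
  assume FG: "F \<in> tuples r schwartz_cylinder" "G \<in> tuples r schwartz_cylinder"
    and eq: "phi l0 l1 r F = phi l0 l1 r G"
  have "F i = G i" if "i < r" for i
  proof (rule W_coeff_inject)
    show "F i \<in> schwartz_cylinder" "G i \<in> schwartz_cylinder"
      using FG that by (auto simp: tuples_def)
    show "W_coeff (F i) = W_coeff (G i)"
    proof (intro ext)
      fix n u
      show "W_coeff (F i) n u = W_coeff (G i) n u"
        \<comment> \<open>The position is chosen so that l0 x + l1 k equals u at k = n r +
          i.\<close>
        using phi_at[OF that, of l0 l1 F "(u - l1 * of_int (n * int r + int i)) / l0" n]
          phi_at[OF that, of l0 l1 G "(u - l1 * of_int (n * int r + int i)) / l0" n] eq \<open>l0 \<noteq> 0\<close>
        by simp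
    qed
  qed
  moreover have "F i = G i" if "i \<ge> r" for i
    using FG that by (simp add: tuples_def)
  ultimately show "F = G"
    by (metis ext not_le)
qed

text \<open>These are the coefficients that the i-th component of a preimage must have: \<xi> on the
  residue class of i modulo r, with u = l0 x + l1 k solved for x.\<close>

lemma rapid_phi_inverse:
  assumes "r \<ge> 1" "l0 \<noteq> 0" and \<xi>: "\<xi> \<in> schwartz_line_int"
  shows "rapid (\<lambda>n u. \<xi> ((u - l1 * of_int (n * int r + int i)) / l0, n * int r + int i))"
proof -
  let ?\<sigma> = "\<lambda>n. n * int r + int i" and ?s = "\<lambda>n. - (l1 * of_int (n * int r + int i)) / l0"
  have "rapid (\<lambda>n u. \<xi> (1 / l0 * u + ?s n, ?\<sigma> n))"
  \<comment> \<open>There is only one family to choose from, so the selector is constantly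
    0.\<close>
  proof (rule rapid_reparam[where r = 1 and \<iota> = "\<lambda>_. 0" and c = "\<lambda>_ k x. \<xi> (x, k)" and s = ?s and \<sigma> = ?\<sigma>])
    show "rapid (\<lambda>k x. \<xi> (x, k))"
      using \<xi> by (simp add: schwartz_line_int_iff_rapid)
    fix u n
    define y where "y = 1 / l0 * u + ?s n"
    let ?w = "weight y (?\<sigma> n)"
    have "\<bar>n\<bar> \<le> \<bar>n * int r\<bar>"
      using \<open>r \<ge> 1\<close> mult_left_mono[of 1 "int r" "\<bar>n\<bar>"] by (simp add: abs_mult)
    also have "\<dots> \<le> \<bar>?\<sigma> n\<bar> + int i"
      by linarith
    finally have "real_of_int \<bar>n\<bar> \<le> real_of_int (\<bar>?\<sigma> n\<bar> + int i)"
      by (simp only: of_int_le_iff)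
    then have "\<bar>real_of_int n\<bar> \<le> \<bar>real_of_int (?\<sigma> n)\<bar> + real i"
      by simp
    also have "\<dots> \<le> ?w + real i * ?w"
      using mult_left_mono[OF weight_ge_1[of y "?\<sigma> n"], of "real i"] by (simp add: weight_def)
    finally have n: "\<bar>real_of_int n\<bar> \<le> ?w + real i * ?w" .
    have "u = l0 * y + l1 * of_int (?\<sigma> n)"
      using \<open>l0 \<noteq> 0\<close> by (simp add: y_def field_simps)
    then have "\<bar>u\<bar> \<le> \<bar>l0\<bar> * \<bar>y\<bar> + \<bar>l1\<bar> * \<bar>of_int (?\<sigma> n)\<bar>"
      by (metis abs_mult abs_triangle_ineq)
    also have "\<dots> \<le> \<bar>l0\<bar> * ?w + \<bar>l1\<bar> * ?w"
      by (intro add_mono mult_left_mono) (auto simp: weight_def)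
    \<comment> \<open>The part 1 of the weight costs 1, |n| costs 1 + i, and |u| costs |l0| +
      |l1|.\<close>
    finally have "weight u n \<le> (2 + real i + \<bar>l0\<bar> + \<bar>l1\<bar>) * ?w"
      using n weight_ge_1[of y "?\<sigma> n"] unfolding weight_def[of u n] distrib_right by linarith
    then show "weight u n \<le> (2 + real i + \<bar>l0\<bar> + \<bar>l1\<bar>) * weight (1 / l0 * u + ?s n) (?\<sigma> n)"
      by (simp only: y_def)
  qed auto
  then show ?thesis
    by (simp add: diff_divide_distrib)
qed

lemma phi_surj:
  assumes "r \<ge> 1" "l0 \<noteq> 0" and \<xi>: "\<xi> \<in> schwartz_line_int"
  shows "\<xi> \<in> phi l0 l1 r ` tuples r schwartz_cylinder"
proof
  let ?c = "\<lambda>i n u. \<xi> ((u - l1 * of_int (n * int r + int i)) / l0, n * int r + int i)"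
  define F where "F i = (if i < r then synth (?c i) else 0)" for i
  have c: "rapid (?c i)" for i
    by (rule rapid_phi_inverse[OF assms])
  show "F \<in> tuples r schwartz_cylinder"
    using synth_in_cylinder[OF c] by (simp add: tuples_def F_def)
  show "\<xi> = phi l0 l1 r F"
  proof (rule ext, rule prod_cases)
    fix x k
    have "nat (k mod int r) < r"
      using \<open>r \<ge> 1\<close> by (simp add: nat_less_iff)
    then have "phi l0 l1 r F (x, k) = ?c (nat (k mod int r)) (k div int r) (l0 * x + l1 * of_int k)"
      by (simp only: phi_def prod.case F_def if_True W_coeff_synth[OF c])
    also have "k div int r * int r + int (nat (k mod int r)) = k"
      using \<open>r \<ge> 1\<close> by simp
    finally show "\<xi> (x, k) = phi l0 l1 r F (x, k)"
      using \<open>l0 \<noteq> 0\<close> by simp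
  qed
qed

text \<open>Subtracting n r from k keeps the remainder and lowers the quotient by n. The action
  therefore stays within one component and matches the convolution there term by term.\<close>

lemma phi_act:
  assumes "r \<ge> 1" and rel: "l0 * \<epsilon> + l1 * real r = - h"
    and a: "a \<in> schwartz_cylinder" and F: "F \<in> tuples r schwartz_cylinder"
  shows "phi l0 l1 r (tuple_act r (C_mult h) a F) = E_act l0 l1 \<epsilon> r a (phi l0 l1 r F)"
proof (rule ext, rule prod_cases)
  fix x k
  define i where "i = nat (k mod int r)"
  define u where "u = l0 * x + l1 * of_int k"
  have i: "i < r"
    using \<open>r \<ge> 1\<close> by (simp add: i_def nat_less_iff)
  then have "F i \<in> schwartz_cylinder"
    using F by (simp add: tuples_def)
  then have "phi l0 l1 r (tuple_act r (C_mult h) a F) (x, k) = conv h (W_coeff a) (W_coeff (F i)) (k div int r) u"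
    using a i by (simp add: phi_def tuple_act_def W_coeff_C_mult flip: i_def u_def)
  also have "\<dots> = (\<Sum>\<^sub>\<infinity>n\<in>UNIV. W_coeff a n u * phi l0 l1 r F (x - of_int n * \<epsilon>, k - n * int r))"
  proof -
    have "phi l0 l1 r F (x - of_int n * \<epsilon>, k - n * int r) = W_coeff (F i) (k div int r - n) (u + of_int n * h)" for n
    proof -
      have "(k - n * int r) mod int r = k mod int r"
        using mod_mult_self1[of k "- n" "int r"] by simp
      moreover have "(k - n * int r) div int r = k div int r - n"
        using \<open>r \<ge> 1\<close> div_mult_self1[of "int r" k "- n"] by simp
      moreover have "l0 * (x - of_int n * \<epsilon>) + l1 * of_int (k - n * int r)
          = u - of_int n * (l0 * \<epsilon> + l1 * real r)"
        by (simp add: u_def algebra_simps)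
      ultimately show ?thesis
        unfolding rel by (simp add: phi_def i_def)
    qed
    then show ?thesis
      by (simp add: conv_def)
  qed
  finally show "phi l0 l1 r (tuple_act r (C_mult h) a F) (x, k) = E_act l0 l1 \<epsilon> r a (phi l0 l1 r F) (x, k)"
    by (simp add: E_act_def u_def)
qed

theorem proposition4p6:
  fixes l0 l1 \<epsilon> h :: real and r :: nat
  assumes "r \<ge> 1"
    and "l0 * \<epsilon> + l1 * real r = - h"
    and "l0 \<noteq> 0"
  shows "left_module_iso
           pscale schwartz_cylinder (C_mult h)
           (tuple_scale pscale) (tuples r schwartz_cylinder) (tuple_act r (C_mult h))
           pscale schwartz_line_int (E_act l0 l1 \<epsilon> r)
           (phi l0 l1 r)"
proof (rule left_module_iso_transport)
  show "left_module pscale schwartz_cylinder (C_mult h) (tuple_scale pscale)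
      (tuples r schwartz_cylinder) (tuple_act r (C_mult h))"
    by (intro left_module_tuples assoc_algebra_cylinder)
  show "complex_subspace pscale schwartz_line_int"
    by (rule complex_subspace_line_int)
  show "bij_betw (phi l0 l1 r) (tuples r schwartz_cylinder) schwartz_line_int"
    unfolding bij_betw_def
    using phi_inj_on[OF assms(3)] phi_in_line_int[OF assms(1,3)] phi_surj[OF assms(1,3)] by blast
  \<comment> \<open>The selected index lies below r, so the component is Schwartz and its
    coefficient integrals are additive.\<close>
  have component: "F (nat (k mod int r)) \<in> schwartz_cylinder" if "F \<in> tuples r schwartz_cylinder" for F k
    using that assms(1) by (simp add: tuples_def nat_less_iff)
  show "phi l0 l1 r (F + G) = phi l0 l1 r F + phi l0 l1 r G"
    if "F \<in> tuples r schwartz_cylinder" "G \<in> tuples r schwartz_cylinder" for F G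
    using component[OF that(1)] component[OF that(2)] by (auto simp: phi_def fun_eq_iff W_coeff_add)
  show "phi l0 l1 r (tuple_scale pscale z F) = pscale z (phi l0 l1 r F)" for F z
    by (auto simp: phi_def tuple_scale_def pscale_def[of z "\<lambda>_. _ _"] W_coeff_pscale fun_eq_iff)
      (simp add: pscale_def)
  show "phi l0 l1 r (tuple_act r (C_mult h) a F) = E_act l0 l1 \<epsilon> r a (phi l0 l1 r F)"
    if "a \<in> schwartz_cylinder" "F \<in> tuples r schwartz_cylinder" for a F
    using assms(1,2) that by (rule phi_act)
qed

end
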